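(* Let $c,\omega,\delta\in\mathbb R$, $\gamma\in\left(\frac13,\frac12\right)$, $2\omega\notin\pi\mathbb Z$, let $\{q_n\}_{n=1}^\infty\in l^1$ be a real sequence, and let $$b_n=\frac{c\sin(2\omega n+\delta)}{n^\gamma}+q_n,\qquad n\ge1.$$ Let $P_n(\lambda)$ be the orthonormal polynomials associated to the Jacobi matrix $\mathcal J=\mathcal J(1,b_n)$. Then for every $z\in\overline{\mathbb D}\cap U$ there exists $F(z)\in\mathbb C$ (the Jost function) such that: (i) if $z\in\mathbb D\setminus\{0\}$ (i.e. $\lambda=z+\frac1z\in\mathbb C\setminus[-2,2]$), then $$P_n\left(z+\frac1z\right)=\frac{zF(z)}{1-z^2}\,\frac1{z^n}\exp\left(\frac{\mu_2(z)n^{1-2\gamma}}{1-2\gamma}\right)+o\left(\frac1{|z|^n}\exp\left(\frac{\mathrm{Re}\,\mu_2(z)\,n^{1-2\gamma}}{1-2\gamma}\right)\right)\quad\text{as }n\to\infty;$$ (ii) if $z\in\mathbb T\cap U$ (i.e. $\lambda=z+\frac1z\in(-2,2)\setminus\{\pm2\cos\omega,\pm2\cos2\omega\}$), then $$P_n\left(z+\frac1z\right)=\frac{zF(z)}{1-z^2}\,\frac1{z^n}\exp\left(\frac{\mu_2(z)n^{1-2\gamma}}{1-2\gamma}\right)+\frac{z\overline{F(z)}}{z^2-1}\,z^n\exp\left(-\frac{\mu_2(z)n^{1-2\gamma}}{1-2\gamma}\right)+o(1)\quad\text{as }n\to\infty.$$ Moreover, the function $F$ is analytic in $\mathbb D\setminus\{0\}$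 and continuous in $\mathbb T\cap U$.
   Context: $\mathbb D$ is the open unit disc in $\mathbb C$, $\overline{\mathbb D}$ its closure, $\mathbb T$ the unit circle. $\mathcal J=\mathcal J(1,b_n)$ is the operator in $l^2=l^2(\mathbb N)$ given by $(\mathcal Ju)_1=b_1u_1+u_2$ and $(\mathcal Ju)_n=u_{n-1}+b_nu_n+u_{n+1}$ for $n\ge2$. The polynomials associated to $\mathcal J$ are defined by $P_1(\lambda)=1$, $P_2(\lambda)=\lambda-b_1$, $P_{n+1}(\lambda)=(\lambda-b_n)P_n(\lambda)-P_{n-1}(\lambda)$ for $n\ge2$. $U:=\mathbb C\setminus\{0,1,-1,e^{\pm i\omega},-e^{\pm i\omega},e^{\pm2i\omega},-e^{\pm2i\omega}\}$. For $z\in U$, $$\mu_2(z):=\frac{c^2z^2(1+z^2)e^{2i\omega}}{4(1-z^2)(z^2-e^{2i\omega})(1-z^2e^{2i\omega})}.$$ *)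

theory Defs
  imports "HOL-Analysis.Analysis" "HOL-Library.Landau_Symbols"
begin

text \<open>
  Polynomials associated to the Jacobi matrix with off-diagonal entries \<open>1\<close> and diagonal
  \<open>b 1, b 2, \<dots>\<close>. Indices start at \<open>1\<close>; \<open>b 0\<close> is never used. The value
  \<open>jacobi_poly b 0 = 0\<close> is only a convention that makes the three-term recurrence
  also produce \<open>P\<^sub>2(\<lambda>) = \<lambda> - b\<^sub>1\<close>.
\<close>

fun jacobi_poly :: "(nat \<Rightarrow> real) \<Rightarrow> nat \<Rightarrow> complex poly" where
  "jacobi_poly b 0 = 0"
| "jacobi_poly b (Suc 0) = 1"
| "jacobi_poly b (Suc (Suc n)) =
     [:- complex_of_real (b (Suc n)), 1:] * jacobi_poly b (Suc n) - jacobi_poly b n"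

lemma jacobi_poly_1: "poly (jacobi_poly b 1) x = 1"
  by simp

lemma jacobi_poly_2: "poly (jacobi_poly b 2) x = x - complex_of_real (b 1)"
  by (simp add: numeral_2_eq_2)

lemma jacobi_poly_rec:
  assumes "n \<ge> 2"
  shows "poly (jacobi_poly b (n + 1)) x =
    (x - complex_of_real (b n)) * poly (jacobi_poly b n) x - poly (jacobi_poly b (n - 1)) x"
  using assms by (cases n) (simp_all add: algebra_simps)

definition jost_domain :: "real \<Rightarrow> complex set" where
  "jost_domain \<omega> = - {0, 1, -1, cis \<omega>, cis (- \<omega>), - cis \<omega>, - cis (- \<omega>),
     cis (2 * \<omega>), cis (- 2 * \<omega>), - cis (2 * \<omega>), - cis (- 2 * \<omega>)}"

definition mu2 :: "real \<Rightarrow> real \<Rightarrow> complex \<Rightarrow> complex" where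
  "mu2 c \<omega> z =
     (complex_of_real c)\<^sup>2 * z\<^sup>2 * (1 + z\<^sup>2) * cis (2 * \<omega>) /
       (4 * (1 - z\<^sup>2) * (z\<^sup>2 - cis (2 * \<omega>)) * (1 - z\<^sup>2 * cis (2 * \<omega>)))"

end

theory Submission
  imports Defs "HOL-Complex_Analysis.Complex_Analysis" "HOL-Real_Asymp.Real_Asymp"
begin

text \<open>
  Write \<open>\<lambda> = z + 1/z\<close>. Averaging the oscillating potential to second order gives an explicit
  approximate Jost solution \<open>J n = z ^ n * exp (- \<mu>\<^sub>2 n powr (1 - 2\<gamma>) / (1 - 2\<gamma>)) * h n\<close>, where
  \<open>h n = 1 + O(n powr -\<gamma>)\<close> collects corrections at the frequencies \<open>\<plusminus>2\<omega>\<close> and \<open>\<plusminus>4\<omega>\<close> that are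
  solvable exactly off the resonant points, and \<open>\<mu>\<^sub>2\<close> is what remains of the second order term at
  frequency zero. The residual of \<open>J\<close> in the three-term recurrence is \<open>O(n powr -3\<gamma> + \<bar>q n\<bar>)\<close>, which
  is summable because \<open>\<gamma> > 1/3\<close>. Hence the Wronskian of \<open>J\<close> with the polynomials converges, locally
  uniformly in \<open>z\<close>, by a discrete Gronwall argument, and its limit is the Jost function \<open>F\<close>.
  Inside the disc the Wronskian is a contracting first-order recurrence for \<open>P n\<close>; on the circle \<open>P n\<close> is
  real, so the Wronskian and its conjugate determine \<open>P n\<close>.
\<close>

section \<open>Recurrences with summable errors\<close>

text \<open>The majorant \<open>M\<close> grows at most by the factors
  \<open>1 + \<epsilon> n\<close>, hence stays below an exponential of the sum of
  \<open>\<epsilon>\<close>, and the increments of \<open>W\<close> are dominated by a summable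
  sequence. \<open>M\<close> is kept apart from the norm of \<open>W\<close> because the disc needs
  a larger majorant than the circle.\<close>

lemma uniform_limit_of_gronwall:
  fixes W :: "nat \<Rightarrow> 'a \<Rightarrow> complex" and M :: "nat \<Rightarrow> 'a \<Rightarrow> real" and \<epsilon> :: "nat \<Rightarrow> real"
  assumes \<epsilon>: "\<And>n. \<epsilon> n \<ge> 0" "summable \<epsilon>"
    and W: "\<And>n z. n \<ge> N \<Longrightarrow> z \<in> K \<Longrightarrow> norm (W (Suc n) z - W n z) \<le> \<epsilon> n * M n z"
    and M: "\<And>n z. n \<ge> N \<Longrightarrow> z \<in> K \<Longrightarrow> M (Suc n) z \<le> (1 + \<epsilon> n) * M n z"
    and B: "\<And>z. z \<in> K \<Longrightarrow> 0 \<le> M N z \<and> M N z \<le> B"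
  obtains F B' where "uniform_limit K W F sequentially"
    "\<And>n z. n \<ge> N \<Longrightarrow> z \<in> K \<Longrightarrow> M n z \<le> B'"
proof -
  \<comment> \<open>The sum runs from 0 instead of \<open>N\<close>; the extra terms are nonnegative
    and only weaken the bound.\<close>
  have exp_bound: "M n z \<le> B * exp (\<Sum>k<n. \<epsilon> k)" if "n \<ge> N" "z \<in> K" for n z
    using \<open>n \<ge> N\<close>
  proof (induction n rule: dec_induct)
    case base
    have "M N z \<le> B" "0 \<le> B" using B \<open>z \<in> K\<close> by (auto intro: order_trans)
    moreover have "1 \<le> exp (\<Sum>k<N. \<epsilon> k)" using \<epsilon> by (simp add: sum_nonneg)
    ultimately show ?case using mult_left_mono[of 1 "exp (\<Sum>k<N. \<epsilon> k)" B] by linarith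
  next
    case (step n)
    have "M (Suc n) z \<le> (1 + \<epsilon> n) * M n z" using M step that by simp
    also have "\<dots> \<le> (1 + \<epsilon> n) * (B * exp (\<Sum>k<n. \<epsilon> k))"
      using step \<epsilon> by (intro mult_left_mono) auto
    also have "\<dots> \<le> exp (\<epsilon> n) * (B * exp (\<Sum>k<n. \<epsilon> k))"
    proof (intro mult_right_mono)
      have "0 \<le> B" using B[OF \<open>z \<in> K\<close>] by simp
      then show "0 \<le> B * exp (\<Sum>k<n. \<epsilon> k)" by simp
    qed simp
    finally show ?case by (simp add: exp_add algebra_simps)
  qed
  \<comment> \<open>For empty \<open>K\<close> the number \<open>B\<close> may be negative; the
    absolute value avoids a case distinction.\<close>
  define B' where "B' = \<bar>B\<bar> * exp (suminf \<epsilon>)"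
  have MB': "M n z \<le> B'" if "n \<ge> N" "z \<in> K" for n z
  proof -
    have "(\<Sum>k<n. \<epsilon> k) \<le> suminf \<epsilon>" using \<epsilon> by (intro sum_le_suminf) auto
    then have "B * exp (\<Sum>k<n. \<epsilon> k) \<le> B'" unfolding B'_def by (intro mult_mono) auto
    then show ?thesis using exp_bound[OF that] by simp
  qed
  have "uniform_limit K (\<lambda>n z. \<Sum>i<n. W (Suc i) z - W i z) (\<lambda>z. \<Sum>i. W (Suc i) z - W i z) sequentially"
  proof (rule Weierstrass_m_test_ev)
    show "\<forall>\<^sub>F n in sequentially. \<forall>z\<in>K. norm (W (Suc n) z - W n z) \<le> \<epsilon> n * B'"
      unfolding eventually_sequentially
      using W MB' \<epsilon>(1) by (meson mult_left_mono order_trans)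
    show "summable (\<lambda>n. \<epsilon> n * B')" using \<epsilon> by (simp add: summable_mult2)
  qed
  then have "uniform_limit K (\<lambda>n z. W 0 z + (\<Sum>i<n. W (Suc i) z - W i z))
      (\<lambda>z. W 0 z + (\<Sum>i. W (Suc i) z - W i z)) sequentially"
    by (intro uniform_limit_intros)
  moreover have "W 0 z + (\<Sum>i<n. W (Suc i) z - W i z) = W n z" for n z
    by (subst sum_lessThan_telescope) simp
  ultimately have "uniform_limit K W (\<lambda>z. W 0 z + (\<Sum>i. W (Suc i) z - W i z)) sequentially"
    by simp
  with MB' that show ?thesis by blast
qed

text \<open>The limit is the fixed point of \<open>x = w * x + D\<close>. The distance to it shrinks
  by a factor \<open>\<rho> < 1\<close> at each step, up to an error that tends to 0.\<close>

lemma affine_recurrence_tendsto: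
  fixes y a d :: "nat \<Rightarrow> complex"
  assumes rec: "\<And>n. n \<ge> N \<Longrightarrow> y (Suc n) = a n * y n + d n"
    and a: "a \<longlonglongrightarrow> w" and d: "d \<longlonglongrightarrow> D" and w: "norm w < 1"
  shows "y \<longlonglongrightarrow> D / (1 - w)"
proof -
  define l where "l = D / (1 - w)"
  have "1 - w \<noteq> 0" using w by auto
  then have l: "l = w * l + D" unfolding l_def by (simp add: field_simps)
  define v where "v n = norm (y n - l)" for n
  define g where "g n = norm (a n * l + d n - l)" for n
  have "(\<lambda>n. a n * l + d n - l) \<longlonglongrightarrow> w * l + D - l" by (intro tendsto_intros a d)
  then have g: "g \<longlonglongrightarrow> 0" unfolding g_def using l tendsto_norm_zero by fastforce
  obtain \<rho> where \<rho>: "norm w < \<rho>" "\<rho> < 1" using w dense by blast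
  have "\<rho> > 0" using \<rho> norm_ge_zero[of w] by linarith
  have "\<forall>\<^sub>F n in sequentially. norm (a n) < \<rho>"
    using order_tendstoD(2)[OF tendsto_norm[OF a] \<rho>(1)] .
  then obtain N1 where N1: "\<And>n. n \<ge> N1 \<Longrightarrow> norm (a n) < \<rho>"
    unfolding eventually_sequentially by blast
  have step: "v (Suc n) \<le> \<rho> * v n + g n" if "n \<ge> max N N1" for n
  proof -
    have "y (Suc n) - l = a n * (y n - l) + (a n * l + d n - l)"
      using rec[of n] that by (simp add: algebra_simps)
    then have "v (Suc n) \<le> norm (a n) * v n + g n"
      unfolding v_def g_def by (metis norm_mult norm_triangle_ineq)
    also have "\<dots> \<le> \<rho> * v n + g n"
      using N1[of n] that by (simp add: v_def mult_right_mono)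
    finally show ?thesis .
  qed
  have "v \<longlonglongrightarrow> 0"
  proof (rule LIMSEQ_I)
    fix r :: real assume "r > 0"
    \<comment> \<open>With this choice \<open>r / 2\<close> is the fixed point of
      \<open>x \<mapsto> \<rho> * x + r1\<close>, so it persists through the iteration.\<close>
    define r1 where "r1 = r / 2 * (1 - \<rho>)"
    have r1: "r1 > 0" using \<open>r > 0\<close> \<rho> by (simp add: r1_def)
    obtain N2 where N2: "\<And>n. n \<ge> N2 \<Longrightarrow> g n < r1"
      using order_tendstoD(2)[OF g r1] unfolding eventually_sequentially by blast
    define N0 where "N0 = max (max N N1) N2"
    have bound: "v (N0 + k) \<le> \<rho> ^ k * v N0 + r / 2" for k
    proof (induction k)
      case 0 then show ?case using \<open>r > 0\<close> by simp
    next
      case (Suc k)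
      have "v (N0 + Suc k) \<le> \<rho> * v (N0 + k) + g (N0 + k)" using step[of "N0 + k"] by (simp add: N0_def del: max.bounded_iff)
      also have "\<dots> \<le> \<rho> * (\<rho> ^ k * v N0 + r / 2) + r1"
        using Suc N2[of "N0 + k"] \<open>\<rho> > 0\<close> by (intro add_mono mult_left_mono) (auto simp: N0_def less_imp_le)
      finally show ?case by (simp add: r1_def field_simps)
    qed
    have "(\<lambda>k. \<rho> ^ k * v N0) \<longlonglongrightarrow> 0 * v N0"
      using \<rho> \<open>\<rho> > 0\<close> by (intro tendsto_intros LIMSEQ_power_zero) auto
    then have "\<forall>\<^sub>F k in sequentially. \<rho> ^ k * v N0 < r / 2"
      using \<open>r > 0\<close> by (intro order_tendstoD(2)[of _ 0]) auto
    then obtain k0 where k0: "\<And>k. k \<ge> k0 \<Longrightarrow> \<rho> ^ k * v N0 < r / 2"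
      unfolding eventually_sequentially by blast
    have "norm (v n - 0) < r" if "n \<ge> N0 + k0" for n
    proof -
      have n: "k0 \<le> n - N0" "N0 + (n - N0) = n" using that by auto
      have "v n < r" using bound[of "n - N0"] k0[OF n(1)] unfolding n(2) by linarith
      then show ?thesis by (simp add: v_def)
    qed
    then show "\<exists>no. \<forall>n\<ge>no. norm (v n - 0) < r" by blast
  qed
  then have "(\<lambda>n. y n - l) \<longlonglongrightarrow> 0" unfolding v_def by (simp add: tendsto_norm_zero_iff)
  then show ?thesis unfolding l_def using LIM_zero_iff by blast
qed

section \<open>Order estimates uniform in a parameter\<close>

text \<open>
  A Landau symbol along \<open>sequentially \<times>\<^sub>F principal K\<close> is an estimate in \<open>n\<close> that is uniform
  for \<open>z \<in> K\<close>, see \<open>eventually_prod_sequentially_principal\<close>.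
\<close>

lemma eventually_prod_sequentially_principal:
  "eventually P (sequentially \<times>\<^sub>F principal K) \<longleftrightarrow> (\<exists>N. \<forall>n\<ge>N. \<forall>z\<in>K. P (n, z))"
  unfolding eventually_prod_filter eventually_principal eventually_sequentially by blast

lemma bigo_fst_sequentially:
  assumes "f \<in> O(g)"
  shows "(\<lambda>x. complex_of_real (f (fst x))) \<in> O[sequentially \<times>\<^sub>F principal K](\<lambda>x. complex_of_real (g (fst x)))"
proof -
  obtain C where "\<forall>\<^sub>F n in sequentially. norm (f n) \<le> C * norm (g n)"
    using assms by (elim landau_o.bigE)
  then show ?thesis
    by (intro bigoI[of _ C]) (auto simp: eventually_prod_sequentially_principal eventually_sequentially)
qed

lemma bigo_snd_compact:
  assumes "compact K" "continuous_on K f"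
  shows "(\<lambda>x. f (snd x) :: complex) \<in> O[sequentially \<times>\<^sub>F principal K](\<lambda>_. 1)"
proof -
  obtain B where "\<And>z. z \<in> K \<Longrightarrow> norm (f z) \<le> B"
    using compact_imp_bounded[OF compact_continuous_image[OF assms(2,1)]]
    unfolding bounded_iff by blast
  then show ?thesis
    by (intro bigoI[of _ B]) (auto simp: eventually_prod_sequentially_principal)
qed

text \<open>Closure rules that let the boundedness of long coefficient expressions be derived by
  following their syntax.\<close>

lemma bigo_one_add: "f \<in> O[F](\<lambda>_. 1) \<Longrightarrow> g \<in> O[F](\<lambda>_. 1) \<Longrightarrow> (\<lambda>x. f x + g x) \<in> O[F](\<lambda>_. 1)"
  and bigo_one_diff: "f \<in> O[F](\<lambda>_. 1) \<Longrightarrow> g \<in> O[F](\<lambda>_. 1) \<Longrightarrow> (\<lambda>x. f x - g x) \<in> O[F](\<lambda>_. 1)"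
  and bigo_one_mult: "f \<in> O[F](\<lambda>_. 1) \<Longrightarrow> g \<in> O[F](\<lambda>_. 1) \<Longrightarrow> (\<lambda>x. f x * g x) \<in> O[F](\<lambda>_. 1)"
  and bigo_one_power: "f \<in> O[F](\<lambda>_. 1) \<Longrightarrow> (\<lambda>x. f x ^ k) \<in> O[F](\<lambda>_. 1)"
  and bigo_one_uminus: "f \<in> O[F](\<lambda>_. 1) \<Longrightarrow> (\<lambda>x. - f x) \<in> O[F](\<lambda>_. 1)"
  for f g :: "'a \<Rightarrow> complex"
  using landau_o.big.mult[of f F "\<lambda>_. 1" g "\<lambda>_. 1"] landau_o.big_power[of f F "\<lambda>_. 1" k]
  by (auto intro: sum_in_bigo)

lemmas bigo_one_intros = bigo_one_add bigo_one_diff bigo_one_mult bigo_one_power bigo_one_uminus bigo_const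

lemma bigo_mult_bounded:
  fixes f g h :: "'a \<Rightarrow> complex"
  shows "f \<in> O[F](g) \<Longrightarrow> h \<in> O[F](\<lambda>_. 1) \<Longrightarrow> (\<lambda>x. f x * h x) \<in> O[F](g)"
  by (rule landau_o.big_1_mult)

text \<open>This is the second order Taylor remainder; a bound on \<open>u\<close> makes the
  constant \<open>exp C\<close> independent of the point.\<close>

lemma exp_minus_linear_bigo:
  fixes u :: "'a \<Rightarrow> complex"
  assumes "u \<in> O[F](\<lambda>_. 1)"
  shows "(\<lambda>x. exp (u x) - 1 - u x) \<in> O[F](\<lambda>x. u x ^ 2)"
proof -
  obtain C where C: "\<forall>\<^sub>F x in F. norm (u x) \<le> C * norm (1::complex)"
    using assms by (elim landau_o.bigE)
  show ?thesis
  proof (rule bigoI[of _ "exp C"])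
    show "\<forall>\<^sub>F x in F. norm (exp (u x) - 1 - u x) \<le> exp C * norm (u x ^ 2)"
      using C
    proof eventually_elim
      case (elim x)
      have "norm (exp (u x) - (\<Sum>k\<le>1. u x ^ k / fact k)) \<le> exp \<bar>Re (u x)\<bar> * norm (u x) ^ Suc 1 / fact 1"
        by (rule Taylor_exp)
      then have "norm (exp (u x) - 1 - u x) \<le> exp \<bar>Re (u x)\<bar> * norm (u x ^ 2)"
        by (simp add: norm_mult power2_eq_square algebra_simps)
      also have "\<dots> \<le> exp C * norm (u x ^ 2)"
        using elim abs_Re_le_cmod[of "u x"] by (intro mult_right_mono) auto
      finally show ?case .
    qed
  qed
qed

text \<open>By the mean value theorem the difference has order
  \<open>n powr (-\<gamma> - 1)\<close>, which the cube absorbs because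
  \<open>\<gamma> < 1 / 2\<close>.\<close>

lemma powr_shift_up_bigo:
  fixes \<gamma> :: real assumes "1 / 3 < \<gamma>" "\<gamma> < 1 / 2"
  shows "(\<lambda>n. real (Suc (Suc n)) powr -\<gamma> - real (Suc n) powr -\<gamma>) \<in> O(\<lambda>n. (real (Suc n) powr -\<gamma>) ^ 3)"
  using assms by real_asymp

lemma powr_shift_down_bigo:
  fixes \<gamma> :: real assumes "1 / 3 < \<gamma>" "\<gamma> < 1 / 2"
  shows "(\<lambda>n. real n powr -\<gamma> - real (Suc n) powr -\<gamma>) \<in> O(\<lambda>n. (real (Suc n) powr -\<gamma>) ^ 3)"
  using assms by real_asymp

text \<open>The derivative of \<open>s\<close> is the square of the amplitude, so one step of
  \<open>s\<close> reproduces that square up to order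
  \<open>n powr (-2 * \<gamma> - 1)\<close>.\<close>

lemma powr_increment_bigo:
  fixes \<gamma> :: real assumes "1 / 3 < \<gamma>" "\<gamma> < 1 / 2"
  defines "s \<equiv> \<lambda>n. real n powr (1 - 2 * \<gamma>) / (1 - 2 * \<gamma>)"
  shows "(\<lambda>n. s (Suc (Suc n)) - s (Suc n) - (real (Suc n) powr -\<gamma>)\<^sup>2) \<in> O(\<lambda>n. (real (Suc n) powr -\<gamma>) ^ 3)"
    and "(\<lambda>n. s (Suc n) - s n - (real (Suc n) powr -\<gamma>)\<^sup>2) \<in> O(\<lambda>n. (real (Suc n) powr -\<gamma>) ^ 3)"
proof -
  \<comment> \<open>The exponents \<open>-2 * \<gamma>\<close> and \<open>-3 * \<gamma>\<close>
    become \<open>a - 1\<close> and \<open>3 * (a - 1) / 2\<close>.\<close>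
  define a where "a = 1 - 2 * \<gamma>"
  have a: "0 < a" "a < 1/3" using assms by (auto simp: a_def)
  have sq: "(real (Suc n) powr -\<gamma>)\<^sup>2 = real (Suc n) powr (a - 1)" for n
    by (simp add: a_def powr_power)
  have cube: "(real (Suc n) powr -\<gamma>) ^ 3 = real (Suc n) powr (3 * (a - 1) / 2)" for n
    by (simp add: a_def powr_power)
  have 1: "(\<lambda>n. real (Suc (Suc n)) powr a - real (Suc n) powr a - a * real (Suc n) powr (a-1))
      \<in> O(\<lambda>n. real (Suc n) powr (3 * (a-1)/2))"
    using a by real_asymp
  have 2: "(\<lambda>n. real (Suc n) powr a - real n powr a - a * real (Suc n) powr (a-1))
      \<in> O(\<lambda>n. real (Suc n) powr (3 * (a-1)/2))"
    using a by real_asymp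
  have split: "(x - y - a * w) = a * (x / a - y / a - w)" for x y w :: real
    using a by (simp add: field_simps)
  show "(\<lambda>n. s (Suc (Suc n)) - s (Suc n) - (real (Suc n) powr -\<gamma>)\<^sup>2) \<in> O(\<lambda>n. (real (Suc n) powr -\<gamma>) ^ 3)"
    using 1 a unfolding s_def sq cube a_def[symmetric] split by simp
  show "(\<lambda>n. s (Suc n) - s n - (real (Suc n) powr -\<gamma>)\<^sup>2) \<in> O(\<lambda>n. (real (Suc n) powr -\<gamma>) ^ 3)"
    using 2 a unfolding s_def sq cube a_def[symmetric] split by simp
qed

section \<open>The approximate Jost solution\<close>

locale oscillating_jacobi =
  fixes c \<omega> \<delta> \<gamma> :: real and q b :: "nat \<Rightarrow> real"
  assumes gamma: "1 / 3 < \<gamma>" "\<gamma> < 1 / 2"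
    and nonresonant: "\<not> (\<exists>k::int. 2 * \<omega> = pi * of_int k)"
    and q_summable: "summable (\<lambda>n. \<bar>q n\<bar>)"
    and b_eq: "\<And>n. n \<ge> 1 \<Longrightarrow> b n = c * sin (2 * \<omega> * real n + \<delta>) / real n powr \<gamma> + q n"
begin

definition e :: complex where "e = cis (2 * \<omega>)"
text \<open>\<open>cp\<close> and \<open>cm\<close> are the Fourier coefficients of \<open>c sin (2\<omega>n + \<delta>)\<close> at \<open>e ^ n\<close> and \<open>e ^ -n\<close>.\<close>

definition cp :: complex where "cp = c * cis \<delta> / (2 * \<i>)"
definition cm :: complex where "cm = - c / (2 * \<i> * cis \<delta>)"

definition t :: "nat \<Rightarrow> real" where "t n = real n powr -\<gamma>"
definition s :: "nat \<Rightarrow> real" where "s n = real n powr (1 - 2 * \<gamma>) / (1 - 2 * \<gamma>)"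

text \<open>
  On sequences \<open>z ^ n * E ^ n\<close> the free difference expression minus \<open>z + 1/z\<close> acts as multiplication by
  \<open>symb z E\<close>. The coefficients \<open>A\<close> cancel the potential at order \<open>n powr -\<gamma>\<close>, the coefficients \<open>B\<close>
  cancel its product with the first correction at the frequencies \<open>\<plusminus>4\<omega>\<close>.
\<close>

definition symb :: "complex \<Rightarrow> complex \<Rightarrow> complex" where
  "symb z E = z * E + 1 / (z * E) - (z + 1 / z)"

definition Ap :: "complex \<Rightarrow> complex" where "Ap z = - cp / symb z e"
definition Am :: "complex \<Rightarrow> complex" where "Am z = - cm / symb z (1 / e)"
definition Bp :: "complex \<Rightarrow> complex" where "Bp z = - cp * Ap z / symb z (e\<^sup>2)"
definition Bm :: "complex \<Rightarrow> complex" where "Bm z = - cm * Am z / symb z (1 / e\<^sup>2)"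

definition wave1 :: "nat \<Rightarrow> complex \<Rightarrow> complex" where
  "wave1 n z = Ap z * e ^ n + Am z * (1 / e ^ n)"
definition wave2 :: "nat \<Rightarrow> complex \<Rightarrow> complex" where
  "wave2 n z = Bp z * (e ^ n)\<^sup>2 + Bm z * (1 / e ^ n)\<^sup>2"
text \<open>
  The amplitude \<open>\<tau>\<close> is a parameter separate from \<open>n\<close>: with \<open>\<tau>\<close> frozen, shifting \<open>n\<close> is exact algebra
  (\<open>ansatz_step\<close>), and the variation of \<open>t n\<close> only costs \<open>O(t n ^ 3)\<close>.
\<close>

definition ansatz :: "complex \<Rightarrow> nat \<Rightarrow> complex \<Rightarrow> complex" where
  "ansatz \<tau> n z = 1 + \<tau> * wave1 n z + \<tau>\<^sup>2 * wave2 n z"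
definition h :: "nat \<Rightarrow> complex \<Rightarrow> complex" where
  "h n z = ansatz (t n) n z"

text \<open>Despite the name, this is the reciprocal of the exponential factor of the polynomials;
  it is the factor that belongs to the Jost solution.\<close>

definition growth :: "nat \<Rightarrow> complex \<Rightarrow> complex" where
  "growth n z = exp (- (mu2 c \<omega> z * s n))"
definition ratio :: "nat \<Rightarrow> complex \<Rightarrow> complex" where
  "ratio n z = exp (- (mu2 c \<omega> z * (s (Suc n) - s n)))"

text \<open>The residual of the approximate Jost solution at \<open>n + 1\<close>, divided by \<open>z ^ (n + 1) * growth (n + 1) z\<close>.\<close>

definition residual :: "nat \<Rightarrow> complex \<Rightarrow> complex" where
  "residual n z = z * ratio (Suc n) z * h (Suc (Suc n)) z + h n z / (ratio n z * z)
     - (z + 1 / z - b (Suc n)) * h (Suc n) z"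

section \<open>Nonresonance and the exact algebra of the ansatz\<close>

lemma e_nz: "e \<noteq> 0" and norm_e: "norm e = 1"
  by (auto simp: e_def)

text \<open>The number \<open>e\<^sup>2 = cis (4 * \<omega>)\<close> equals 1 only if
  \<open>2 * \<omega>\<close> is an integer multiple of \<open>pi\<close>; this is how the
  hypothesis on \<open>\<omega>\<close> enters.\<close>

lemma e_sq: "e\<^sup>2 \<noteq> 1" and e_ne_1: "e \<noteq> 1"
proof -
  show *: "e\<^sup>2 \<noteq> 1"
  proof
    assume "e\<^sup>2 = 1"
    then have "cis (4 * \<omega>) = 1" by (simp add: e_def cis_mult power2_eq_square)
    then have "cos (4 * \<omega>) = 1" by (metis cis.sel(1) one_complex.sel(1))
    then obtain k :: int where "4 * \<omega> = of_int k * 2 * pi" by (auto simp: cos_one_2pi_int)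
    then have "2 * \<omega> = pi * of_int k" by simp
    then show False using nonresonant by blast
  qed
  then show "e \<noteq> 1" by auto
qed

text \<open>Apart from 0, the removed points come in pairs \<open>w\<close>, \<open>-w\<close>, so
  the conditions can be expressed through \<open>z\<^sup>2\<close> alone.\<close>

lemma jost_domainD:
  assumes "z \<in> jost_domain \<omega>"
  shows "z \<noteq> 0" "z\<^sup>2 \<noteq> 1" "z\<^sup>2 \<noteq> e" "z\<^sup>2 * e \<noteq> 1" "z\<^sup>2 \<noteq> e\<^sup>2" "z\<^sup>2 * e\<^sup>2 \<noteq> 1"
proof -
  have sq: "z\<^sup>2 \<noteq> w\<^sup>2" if "z \<noteq> w" "z \<noteq> -w" for w using that by (simp add: power2_eq_iff)
  have z: "z \<noteq> 0" "z \<noteq> 1" "z \<noteq> -1" "z \<noteq> cis \<omega>" "z \<noteq> - cis \<omega>" "z \<noteq> cis (-\<omega>)" "z \<noteq> - cis (-\<omega>)"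
    "z \<noteq> cis (2*\<omega>)" "z \<noteq> - cis (2*\<omega>)" "z \<noteq> cis (-2*\<omega>)" "z \<noteq> - cis (-2*\<omega>)"
    using assms by (auto simp: jost_domain_def)
  show "z \<noteq> 0" by fact
  show "z\<^sup>2 \<noteq> 1" using sq[of 1] z by simp
  show "z\<^sup>2 \<noteq> e" using sq[of "cis \<omega>"] z by (simp add: e_def power2_eq_square cis_mult)
  show "z\<^sup>2 \<noteq> e\<^sup>2" using sq[of "cis (2*\<omega>)"] z by (simp add: e_def)
  have inv: "z\<^sup>2 * w \<noteq> 1" if "z\<^sup>2 \<noteq> v" "w * v = 1" for v w
  proof
    assume "z\<^sup>2 * w = 1"
    then have "z\<^sup>2 * (w * v) = v" by (metis mult.assoc mult_1)
    then show False using that by simp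
  qed
  show "z\<^sup>2 * e \<noteq> 1" using inv[of "(cis (-\<omega>))\<^sup>2" e] sq[of "cis (-\<omega>)"] z
    by (simp add: e_def power2_eq_square cis_mult)
  show "z\<^sup>2 * e\<^sup>2 \<noteq> 1" using inv[of "(cis (-2*\<omega>))\<^sup>2" "e\<^sup>2"] sq[of "cis (-2*\<omega>)"] z
    by (simp add: e_def power2_eq_square cis_mult)
qed

text \<open>The factorization displays the resonances: for \<open>E \<noteq> 1\<close> the symbol
  vanishes exactly when \<open>z\<^sup>2 * E = 1\<close>.\<close>

lemma symb_eq: "z \<noteq> 0 \<Longrightarrow> E \<noteq> 0 \<Longrightarrow> symb z E = (E - 1) * (z\<^sup>2 * E - 1) / (z * E)"
  by (simp add: symb_def field_simps power2_eq_square)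

lemma symb_nz:
  assumes "z \<in> jost_domain \<omega>"
  shows "symb z e \<noteq> 0" "symb z (1 / e) \<noteq> 0" "symb z (e\<^sup>2) \<noteq> 0" "symb z (1 / e\<^sup>2) \<noteq> 0"
proof -
  note z = jost_domainD[OF assms]
  have nz: "symb z E \<noteq> 0" if "E \<noteq> 0" "E \<noteq> 1" "z\<^sup>2 * E \<noteq> 1" for E
    using that z by (simp add: symb_eq)
  show "symb z e \<noteq> 0" using z e_nz e_ne_1 by (intro nz) auto
  show "symb z (1 / e) \<noteq> 0" using z e_nz e_ne_1 by (intro nz) auto
  show "symb z (e\<^sup>2) \<noteq> 0" using z e_nz e_sq by (intro nz) auto
  show "symb z (1 / e\<^sup>2) \<noteq> 0" using z e_nz e_sq by (intro nz) auto
qed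

text \<open>The terms of the residual of order \<open>t n ^ 2\<close> at frequency zero; this is what determines \<open>mu2\<close>.\<close>

lemma mu2_balance:
  assumes "z \<in> jost_domain \<omega>"
  shows "- z * mu2 c \<omega> z + mu2 c \<omega> z / z + cp * Am z + cm * Ap z = 0"
proof -
  note z = jost_domainD[OF assms]
  define m where "m = (complex_of_real c)\<^sup>2 / 4"
  \<comment> \<open>The phase \<open>\<delta>\<close> cancels in the product of the Fourier
    coefficients, which is why \<open>mu2\<close> does not depend on it.\<close>
  have cc: "cp * cm = m" "cm * cp = m"
    by (auto simp: cp_def cm_def m_def field_simps power2_eq_square)
  have nz: "e - 1 \<noteq> 0" "z\<^sup>2 * e - 1 \<noteq> 0" "z\<^sup>2 - e \<noteq> 0" "1 - z\<^sup>2 \<noteq> 0" "1 - e \<noteq> 0" "1 - z\<^sup>2 * e \<noteq> 0"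
    using z e_ne_1 by auto
  have 1: "1 / symb z e = z * e / ((e - 1) * (z\<^sup>2 * e - 1))"
    using z e_nz by (simp add: symb_eq)
  have 2: "1 / symb z (1 / e) = z * e / ((1 - e) * (z\<^sup>2 - e))"
  proof -
    have "symb z (1 / e) = (1 - e) * (z\<^sup>2 - e) / (z * e)"
      using z e_nz by (simp add: symb_eq field_simps)
    then show ?thesis by simp
  qed
  have "cp * Am z + cm * Ap z = - m * (1 / symb z (1 / e)) - m * (1 / symb z e)"
    using cc by (simp add: Ap_def Am_def field_simps)
  also have "\<dots> = m * z * e * (1 + z\<^sup>2) / ((z\<^sup>2 * e - 1) * (z\<^sup>2 - e))"
    unfolding 1 2 using nz by (simp add: divide_simps) (simp add: algebra_simps power2_eq_square)
  also have "\<dots> = z * mu2 c \<omega> z - mu2 c \<omega> z / z"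
  proof -
    have "mu2 c \<omega> z = m * z\<^sup>2 * (1 + z\<^sup>2) * e / ((1 - z\<^sup>2) * (z\<^sup>2 - e) * (1 - z\<^sup>2 * e))"
      by (simp add: mu2_def m_def e_def)
    then show ?thesis using nz z by (simp add: divide_simps) (simp add: algebra_simps power2_eq_square)
  qed
  finally show ?thesis by (simp add: add.assoc)
qed

text \<open>Euler's formula splits the potential into its two frequencies. The index is shifted
  because nothing is assumed about \<open>b 0\<close>.\<close>

lemma b_Suc: "complex_of_real (b (Suc n)) = t (Suc n) * (cp * e ^ Suc n + cm * (1 / e ^ Suc n)) + q (Suc n)"
proof -
  define x where "x = 2 * \<omega> * real (Suc n)"
  have e: "e ^ Suc n = cis x" unfolding e_def x_def by (simp only: Complex.DeMoivre) (simp add: mult.commute)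
  have "complex_of_real (sin y) = (cis y - cis (- y)) / (2 * \<i>)" for y
    by (simp add: complex_eq_iff)
  from this[of "x + \<delta>"]
  have "complex_of_real (sin (x + \<delta>)) = (cis (x + \<delta>) - cis (- (x + \<delta>))) / (2 * \<i>)" .
  also have "complex_of_real c * \<dots> = cp * e ^ Suc n + cm * (1 / e ^ Suc n)"
    unfolding e cp_def cm_def
    unfolding cis_inverse[symmetric] cis_mult[symmetric] by (simp add: field_simps)
  finally have *: "complex_of_real c * complex_of_real (sin (x + \<delta>)) = cp * e ^ Suc n + cm * (1 / e ^ Suc n)" .
  have "b (Suc n) = t (Suc n) * (c * sin (x + \<delta>)) + q (Suc n)"
    using b_eq[of "Suc n"] by (simp add: t_def x_def powr_minus divide_inverse mult_ac del: of_nat_Suc)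
  then show ?thesis by (simp only: of_real_add of_real_mult *)
qed

lemma symb_wave:
  "z \<noteq> 0 \<Longrightarrow> E \<noteq> 0 \<Longrightarrow> z * (E * x) + x / E / z - (z + 1 / z) * x = symb z E * x"
  by (simp add: symb_def field_simps)

text \<open>Each summand of the ansatz is a geometric wave, on which the difference expression acts
  by its symbol; the constant 1 is annihilated because \<open>symb z 1 = 0\<close>. The denominators
  of the coefficients cancel the symbols.\<close>

lemma ansatz_step:
  assumes "z \<in> jost_domain \<omega>"
  shows "z * ansatz \<tau> (Suc (Suc n)) z + ansatz \<tau> n z / z - (z + 1 / z) * ansatz \<tau> (Suc n) z =
    - \<tau> * (cp * e ^ Suc n + cm * (1 / e ^ Suc n))
    - \<tau>\<^sup>2 * (cp * Ap z * (e ^ Suc n)\<^sup>2 + cm * Am z * (1 / e ^ Suc n)\<^sup>2)"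
proof -
  note z = jost_domainD(1)[OF assms]
  note nz = symb_nz[OF assms]
  define L where "L x y w = z * x + y / z - (z + 1 / z) * w" for x y w
  have linear: "z * (1 + \<tau> * (a * x1 + a' * x2) + \<tau>\<^sup>2 * (d * x3 + d' * x4))
      + (1 + \<tau> * (a * y1 + a' * y2) + \<tau>\<^sup>2 * (d * y3 + d' * y4)) / z
      - (z + 1 / z) * (1 + \<tau> * (a * w1 + a' * w2) + \<tau>\<^sup>2 * (d * w3 + d' * w4))
    = \<tau> * (a * L x1 y1 w1 + a' * L x2 y2 w2) + \<tau>\<^sup>2 * (d * L x3 y3 w3 + d' * L x4 y4 w4)"
    for a a' d d' x1 x2 x3 x4 y1 y2 y3 y4 w1 w2 w3 w4
    unfolding L_def by (simp add: algebra_simps add_divide_distrib)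
  have L: "L (E * x) (x / E) x = symb z E * x" if "E \<noteq> 0" for E x
    unfolding L_def using z that by (rule symb_wave)
  have "z * ansatz \<tau> (Suc (Suc n)) z + ansatz \<tau> n z / z - (z + 1 / z) * ansatz \<tau> (Suc n) z =
     \<tau> * (Ap z * (symb z e * e ^ Suc n) + Am z * (symb z (1 / e) * (1 / e ^ Suc n)))
     + \<tau>\<^sup>2 * (Bp z * (symb z (e\<^sup>2) * (e ^ Suc n)\<^sup>2) + Bm z * (symb z (1 / e\<^sup>2) * (1 / e ^ Suc n)\<^sup>2))"
    unfolding ansatz_def wave1_def wave2_def linear
    using L[of e "e ^ Suc n"] L[of "1 / e" "1 / e ^ Suc n"]
      L[of "e\<^sup>2" "(e ^ Suc n)\<^sup>2"] L[of "1 / e\<^sup>2" "(1 / e ^ Suc n)\<^sup>2"] e_nz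
    by (simp add: power_mult_distrib power_one_over)
  then show ?thesis
    unfolding Ap_def Am_def Bp_def Bm_def using nz by (simp add: algebra_simps)
qed

text \<open>Replacing \<open>ratio\<close> and its reciprocal by
  \<open>1 - \<mu> * \<tau>\<^sup>2\<close> and \<open>1 + \<mu> * \<tau>\<^sup>2\<close>, and
  \<open>h\<close> by the ansatz with frozen amplitude, produces the first four terms. After that,
  \<open>ansatz_step\<close> and \<open>mu2_balance\<close> remove everything of order below
  \<open>\<tau> ^ 3\<close> except the contribution of \<open>q\<close>.\<close>

lemma residual_decomposition:
  fixes n z
  assumes "z \<in> jost_domain \<omega>"
  defines "\<mu> \<equiv> mu2 c \<omega> z" and "\<tau> \<equiv> complex_of_real (t (Suc n))"
  shows "residual n z =
      z * (ratio (Suc n) z - 1 + \<mu> * \<tau>\<^sup>2) * h (Suc (Suc n)) z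
    + (1 / ratio n z - 1 - \<mu> * \<tau>\<^sup>2) * h n z * (1 / z)
    + z * (1 - \<mu> * \<tau>\<^sup>2) * (h (Suc (Suc n)) z - ansatz \<tau> (Suc (Suc n)) z)
    + (1 + \<mu> * \<tau>\<^sup>2) * (1 / z) * (h n z - ansatz \<tau> n z)
    + q (Suc n) * h (Suc n) z
    + \<tau> ^ 3 * (- z * \<mu> * (wave1 (Suc (Suc n)) z + \<tau> * wave2 (Suc (Suc n)) z)
        + \<mu> * (wave1 n z + \<tau> * wave2 n z) * (1 / z)
        + (cp * e ^ Suc n + cm * (1 / e ^ Suc n)) * wave2 (Suc n) z)"
proof -
  note z = jost_domainD(1)[OF assms(1)]
  define P where "P = e ^ Suc n"
  define R where "R = 1 / P"
  have PR: "P * R = 1" using e_nz by (simp add: P_def R_def)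
  define \<zeta> where "\<zeta> = 1 / z"
  define H1 where "H1 = ansatz \<tau> (Suc (Suc n)) z"
  define H0 where "H0 = ansatz \<tau> n z"
  define k1 where "k1 = wave1 (Suc (Suc n)) z + \<tau> * wave2 (Suc (Suc n)) z"
  define k0 where "k0 = wave1 n z + \<tau> * wave2 n z"
  define w1 where "w1 = wave1 (Suc n) z"
  define w2 where "w2 = wave2 (Suc n) z"
  define \<beta> where "\<beta> = cp * P + cm * R"
  have H: "H1 = 1 + \<tau> * k1" "H0 = 1 + \<tau> * k0" "h (Suc n) z = 1 + \<tau> * w1 + \<tau>\<^sup>2 * w2"
    by (auto simp: H1_def H0_def k1_def k0_def w1_def w2_def h_def ansatz_def \<tau>_def algebra_simps power2_eq_square)
  have w1: "w1 = Ap z * P + Am z * R" by (simp add: w1_def wave1_def P_def R_def)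
  have b: "complex_of_real (b (Suc n)) = \<tau> * \<beta> + q (Suc n)"
    unfolding b_Suc \<tau>_def \<beta>_def P_def R_def ..
  have step: "z * H1 + H0 * \<zeta> - (z + \<zeta>) * h (Suc n) z = - \<tau> * \<beta> - \<tau>\<^sup>2 * (cp * Ap z * P\<^sup>2 + cm * Am z * R\<^sup>2)"
    using ansatz_step[OF assms(1), of \<tau> n]
    unfolding H1_def H0_def h_def \<tau>_def \<beta>_def P_def R_def \<zeta>_def by simp
  have bal: "- z * \<mu> + \<mu> * \<zeta> + cp * Am z + cm * Ap z = 0"
    using mu2_balance[OF assms(1)] by (simp add: \<mu>_def \<zeta>_def)
  \<comment> \<open>The cross terms, where \<open>P * R = 1\<close>, form the part at frequency
    zero. The balance identity turns it into a drift that the factor \<open>growth\<close>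
    compensates.\<close>
  have \<beta>w: "\<beta> * w1 = cp * Ap z * P\<^sup>2 + cm * Am z * R\<^sup>2 + (cp * Am z + cm * Ap z)"
    unfolding \<beta>_def w1 using PR by algebra
  have residual: "residual n z = z * ratio (Suc n) z * h (Suc (Suc n)) z + (1 / ratio n z) * h n z * \<zeta>
      - (z + \<zeta> - (\<tau> * \<beta> + q (Suc n))) * h (Suc n) z"
    unfolding residual_def b by (simp add: \<zeta>_def)
  define V where "V = cp * Ap z * P\<^sup>2 + cm * Am z * R\<^sup>2"
  have "\<beta> * w1 = V + (z * \<mu> - \<mu> * \<zeta>)"
    unfolding \<beta>w V_def using bal by (simp add: algebra_simps add_eq_0_iff)
  moreover have "\<tau> * \<beta> * h (Suc n) z = \<tau> * \<beta> + \<tau>\<^sup>2 * (\<beta> * w1) + \<tau> ^ 3 * (\<beta> * w2)"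
    unfolding H(3) by (simp add: algebra_simps power2_eq_square power3_eq_cube)
  ultimately have "\<tau> * \<beta> * h (Suc n) z = \<tau> * \<beta> + \<tau>\<^sup>2 * V + \<tau>\<^sup>2 * (z * \<mu> - \<mu> * \<zeta>) + \<tau> ^ 3 * (\<beta> * w2)"
    by (simp add: ring_distribs)
  also have "\<dots> = \<tau> * \<beta> + \<tau>\<^sup>2 * V + \<tau>\<^sup>2 * \<mu> * (z * H1 - \<zeta> * H0)
      + \<tau> ^ 3 * (- z * \<mu> * k1 + \<mu> * k0 * \<zeta> + \<beta> * w2)"
    unfolding H by (simp add: algebra_simps power2_eq_square power3_eq_cube)
  also have "\<tau> * \<beta> + \<tau>\<^sup>2 * V = (z + \<zeta>) * h (Suc n) z - z * H1 - H0 * \<zeta>"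
    using step unfolding V_def by (simp add: algebra_simps)
  finally have key: "(z + \<zeta>) * h (Suc n) z = \<tau> * \<beta> * h (Suc n) z + z * H1 + H0 * \<zeta>
      - \<tau>\<^sup>2 * \<mu> * (z * H1 - \<zeta> * H0) - \<tau> ^ 3 * (- z * \<mu> * k1 + \<mu> * k0 * \<zeta> + \<beta> * w2)"
    by simp
  have residual': "residual n z = z * ratio (Suc n) z * h (Suc (Suc n)) z + (1 / ratio n z) * h n z * \<zeta>
      + \<tau> * \<beta> * h (Suc n) z + q (Suc n) * h (Suc n) z - (z + \<zeta>) * h (Suc n) z"
    unfolding residual by (simp add: ring_distribs)
  show ?thesis
    unfolding residual' key H1_def[symmetric] H0_def[symmetric] k1_def[symmetric] k0_def[symmetric]
      w2_def[symmetric] \<zeta>_def[symmetric] P_def[symmetric] R_def[symmetric] \<beta>_def[symmetric]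
    by (simp add: algebra_simps)
qed

lemma holomorphic_coeffs:
  "mu2 c \<omega> holomorphic_on jost_domain \<omega>" "Ap holomorphic_on jost_domain \<omega>" "Am holomorphic_on jost_domain \<omega>"
  "Bp holomorphic_on jost_domain \<omega>" "Bm holomorphic_on jost_domain \<omega>"
proof -
  have nz: "z \<noteq> 0" "1 - z\<^sup>2 \<noteq> 0" "z\<^sup>2 - cis (2 * \<omega>) \<noteq> 0" "1 - z\<^sup>2 * cis (2 * \<omega>) \<noteq> 0"
    "symb z e \<noteq> 0" "symb z (1 / e) \<noteq> 0" "symb z (e\<^sup>2) \<noteq> 0" "symb z (1 / e\<^sup>2) \<noteq> 0"
    if "z \<in> jost_domain \<omega>" for z
    using that jost_domainD[of z] symb_nz[of z] by (auto simp: e_def)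
  have symb: "(\<lambda>z. symb z E) holomorphic_on jost_domain \<omega>" if "E \<noteq> 0" for E
    unfolding symb_def using nz that by (intro holomorphic_intros) auto
  show "mu2 c \<omega> holomorphic_on jost_domain \<omega>"
    unfolding mu2_def using nz by (intro holomorphic_intros) auto
  show A: "Ap holomorphic_on jost_domain \<omega>" "Am holomorphic_on jost_domain \<omega>"
    unfolding Ap_def Am_def using nz e_nz by (auto intro!: holomorphic_intros symb)
  show "Bp holomorphic_on jost_domain \<omega>" "Bm holomorphic_on jost_domain \<omega>"
    unfolding Bp_def Bm_def using nz e_nz by (auto intro!: holomorphic_intros symb A)
qed

section \<open>Estimates uniform on a compact subset of the domain\<close>

context
  fixes K :: "complex set"
  assumes K: "compact K" "K \<subseteq> jost_domain \<omega>"
begin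

abbreviation UF :: "(nat \<times> complex) filter" where "UF \<equiv> sequentially \<times>\<^sub>F principal K"

lemma coeffs_bigo:
  "(\<lambda>x. mu2 c \<omega> (snd x)) \<in> O[UF](\<lambda>_. 1)"
  "(\<lambda>x. Ap (snd x)) \<in> O[UF](\<lambda>_. 1)" "(\<lambda>x. Am (snd x)) \<in> O[UF](\<lambda>_. 1)"
  "(\<lambda>x. Bp (snd x)) \<in> O[UF](\<lambda>_. 1)" "(\<lambda>x. Bm (snd x)) \<in> O[UF](\<lambda>_. 1)"
  "(\<lambda>x. snd x) \<in> O[UF](\<lambda>_. 1)" "(\<lambda>x. 1 / snd x) \<in> O[UF](\<lambda>_. 1)"
proof -
  have hol: "(\<lambda>x. f (snd x)) \<in> O[UF](\<lambda>_. 1)" if "f holomorphic_on jost_domain \<omega>" for f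
    using that K by (intro bigo_snd_compact holomorphic_on_imp_continuous_on) (auto intro: holomorphic_on_subset)
  note * = holomorphic_coeffs[THEN hol]
  show "(\<lambda>x. mu2 c \<omega> (snd x)) \<in> O[UF](\<lambda>_. 1)"
    "(\<lambda>x. Ap (snd x)) \<in> O[UF](\<lambda>_. 1)" "(\<lambda>x. Am (snd x)) \<in> O[UF](\<lambda>_. 1)"
    "(\<lambda>x. Bp (snd x)) \<in> O[UF](\<lambda>_. 1)" "(\<lambda>x. Bm (snd x)) \<in> O[UF](\<lambda>_. 1)"
    by (fact *)+
  show "(\<lambda>x. snd x) \<in> O[UF](\<lambda>_. 1)"
    by (rule hol) (intro holomorphic_intros)
  show "(\<lambda>x. 1 / snd x) \<in> O[UF](\<lambda>_. 1)"
    by (rule hol) (auto intro!: holomorphic_intros dest: jost_domainD)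
qed

lemma e_power_bigo:
  "(\<lambda>x. e ^ f x) \<in> O[F](\<lambda>_. 1)" "(\<lambda>x. 1 / e ^ f x) \<in> O[F](\<lambda>_. 1)"
  by (auto intro!: bigoI[of _ 1] simp: norm_power norm_e norm_divide)

lemma wave_bigo:
  "(\<lambda>x. wave1 (f x) (snd x)) \<in> O[UF](\<lambda>_. 1)" "(\<lambda>x. wave2 (f x) (snd x)) \<in> O[UF](\<lambda>_. 1)"
  unfolding wave1_def wave2_def by (intro bigo_one_intros coeffs_bigo e_power_bigo)+

lemma t_bigo: "(\<lambda>x. complex_of_real (t (f x))) \<in> O[F](\<lambda>_. 1)"
proof -
  have "t n \<le> 1" for n
    using gamma by (cases n) (auto simp: t_def intro!: powr_le1 simp: powr_minus field_simps ge_one_powr_ge_zero)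
  then show ?thesis
    by (intro bigoI[of _ 1]) (auto simp: t_def)
qed

lemma h_bigo: "(\<lambda>x. h (f x) (snd x)) \<in> O[UF](\<lambda>_. 1)"
  unfolding h_def ansatz_def by (intro bigo_one_intros wave_bigo t_bigo)

text \<open>The exponent is \<open>\<minusplus>mu2\<close> times an increment of \<open>s\<close>,
  that is, times \<open>t\<^sup>2\<close> up to order \<open>t ^ 3\<close>; the quadratic Taylor
  remainder has order \<open>t ^ 4\<close>.\<close>

lemma residual_factor_bigo:
  "(\<lambda>x. ratio (Suc (fst x)) (snd x) - 1 + mu2 c \<omega> (snd x) * (complex_of_real (t (Suc (fst x))))\<^sup>2)
     \<in> O[UF](\<lambda>x. complex_of_real (t (Suc (fst x))) ^ 3)"
  "(\<lambda>x. 1 / ratio (fst x) (snd x) - 1 - mu2 c \<omega> (snd x) * (complex_of_real (t (Suc (fst x))))\<^sup>2)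
     \<in> O[UF](\<lambda>x. complex_of_real (t (Suc (fst x))) ^ 3)"
proof -
  \<comment> \<open>The sign \<open>\<sigma>\<close> is \<open>-1\<close> for \<open>ratio\<close>
    and \<open>1\<close> for its reciprocal.\<close>
  have aux: "(\<lambda>x. exp (v x) - 1 - \<sigma> * mu2 c \<omega> (snd x) * (complex_of_real (t (Suc (fst x))))\<^sup>2)
     \<in> O[UF](\<lambda>x. complex_of_real (t (Suc (fst x))) ^ 3)"
    if d: "(\<lambda>n. d n - (t (Suc n))\<^sup>2) \<in> O(\<lambda>n. t (Suc n) ^ 3)"
      and v: "\<And>x. v x = \<sigma> * mu2 c \<omega> (snd x) * complex_of_real (d (fst x))" for v d \<sigma>
  proof -
    define T where "T x = complex_of_real (t (Suc (fst x)))" for x :: "nat \<times> complex"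
    define \<mu> where "\<mu> x = \<sigma> * mu2 c \<omega> (snd x)" for x :: "nat \<times> complex"
    have \<mu>: "\<mu> \<in> O[UF](\<lambda>_. 1)" unfolding \<mu>_def by (intro bigo_one_intros coeffs_bigo)
    have T1: "T \<in> O[UF](\<lambda>_. 1)" unfolding T_def by (rule t_bigo)
    have lin: "(\<lambda>x. complex_of_real (d (fst x)) - T x ^ 2) \<in> O[UF](\<lambda>x. T x ^ 3)"
      using bigo_fst_sequentially[OF d, of K] by (simp add: T_def)
    have T32: "(\<lambda>x. T x ^ 3) \<in> O[UF](\<lambda>x. T x ^ 2)"
      using bigo_mult_bounded[of "\<lambda>x. T x ^ 2" UF "\<lambda>x. T x ^ 2" T] T1
      by (simp add: power2_eq_square power3_eq_cube)
    have T43: "(\<lambda>x. (T x ^ 2)\<^sup>2) \<in> O[UF](\<lambda>x. T x ^ 3)"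
      using bigo_mult_bounded[of "\<lambda>x. T x ^ 3" UF "\<lambda>x. T x ^ 3" T] T1
      by (simp add: power2_eq_square power3_eq_cube mult.assoc)
    have "(\<lambda>x. (complex_of_real (d (fst x)) - T x ^ 2) + T x ^ 2) \<in> O[UF](\<lambda>x. T x ^ 2)"
      by (rule sum_in_bigo(1)[OF landau_o.big_trans[OF lin T32] landau_o.big_refl])
    then have dT: "(\<lambda>x. complex_of_real (d (fst x))) \<in> O[UF](\<lambda>x. T x ^ 2)" by simp
    have "v = (\<lambda>x. complex_of_real (d (fst x)) * \<mu> x)" by (auto simp: fun_eq_iff v \<mu>_def)
    then have v2: "v \<in> O[UF](\<lambda>x. T x ^ 2)"
      using bigo_mult_bounded[OF dT \<mu>] by simp
    have "(\<lambda>x. T x ^ 2) \<in> O[UF](\<lambda>_. 1)" by (intro bigo_one_intros T1)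
    with v2 have v1: "v \<in> O[UF](\<lambda>_. 1)" by (rule landau_o.big_trans)
    have "(\<lambda>x. v x ^ 2) \<in> O[UF](\<lambda>x. (T x ^ 2) ^ 2)" by (rule landau_o.big_power[OF v2])
    from landau_o.big_trans[OF landau_o.big_trans[OF exp_minus_linear_bigo[OF v1] this] T43]
    have "(\<lambda>x. exp (v x) - 1 - v x) \<in> O[UF](\<lambda>x. T x ^ 3)" .
    moreover have "(\<lambda>x. v x - \<mu> x * T x ^ 2) \<in> O[UF](\<lambda>x. T x ^ 3)"
      using bigo_mult_bounded[OF lin \<mu>] by (simp add: v \<mu>_def algebra_simps)
    ultimately have "(\<lambda>x. (exp (v x) - 1 - v x) + (v x - \<mu> x * T x ^ 2)) \<in> O[UF](\<lambda>x. T x ^ 3)"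
      by (rule sum_in_bigo)
    moreover have "(\<lambda>x. (exp (v x) - 1 - v x) + (v x - \<mu> x * T x ^ 2)) = (\<lambda>x. exp (v x) - 1 - \<mu> x * T x ^ 2)"
      by (simp add: fun_eq_iff)
    ultimately show ?thesis by (simp only: T_def \<mu>_def)
  qed
  have t: "(\<lambda>n. s (Suc (Suc n)) - s (Suc n) - (t (Suc n))\<^sup>2) \<in> O(\<lambda>n. t (Suc n) ^ 3)"
    "(\<lambda>n. s (Suc n) - s n - (t (Suc n))\<^sup>2) \<in> O(\<lambda>n. t (Suc n) ^ 3)"
    using powr_increment_bigo[OF gamma] by (simp_all add: s_def t_def)
  show "(\<lambda>x. ratio (Suc (fst x)) (snd x) - 1 + mu2 c \<omega> (snd x) * (complex_of_real (t (Suc (fst x))))\<^sup>2)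
     \<in> O[UF](\<lambda>x. complex_of_real (t (Suc (fst x))) ^ 3)"
    using aux[OF t(1), of "\<lambda>x. - (mu2 c \<omega> (snd x) * (s (Suc (Suc (fst x))) - s (Suc (fst x))))" "-1"]
    by (simp add: ratio_def)
  have "1 / ratio n z = exp (mu2 c \<omega> z * (s (Suc n) - s n))" for n z
    by (simp add: ratio_def exp_minus inverse_eq_divide)
  then show "(\<lambda>x. 1 / ratio (fst x) (snd x) - 1 - mu2 c \<omega> (snd x) * (complex_of_real (t (Suc (fst x))))\<^sup>2)
     \<in> O[UF](\<lambda>x. complex_of_real (t (Suc (fst x))) ^ 3)"
    using aux[OF t(2), of "\<lambda>x. (mu2 c \<omega> (snd x) * (s (Suc (fst x)) - s (fst x)))" "1"]
    by simp
qed

text \<open>Only the amplitudes differ, so \<open>t (k n) - t (Suc n)\<close> factors out. The index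
  \<open>k n\<close> will be \<open>n + 2\<close> or \<open>n\<close>.\<close>

lemma ansatz_shift_bigo:
  assumes d: "(\<lambda>n. t (k n) - t (Suc n)) \<in> O(\<lambda>n. t (Suc n) ^ 3)"
  shows "(\<lambda>x. h (k (fst x)) (snd x) - ansatz (t (Suc (fst x))) (k (fst x)) (snd x))
    \<in> O[UF](\<lambda>x. complex_of_real (t (Suc (fst x))) ^ 3)"
proof -
  have eq: "h (k (fst x)) (snd x) - ansatz (t (Suc (fst x))) (k (fst x)) (snd x) =
     complex_of_real (t (k (fst x)) - t (Suc (fst x))) * (wave1 (k (fst x)) (snd x)
      + (complex_of_real (t (k (fst x))) + complex_of_real (t (Suc (fst x)))) * wave2 (k (fst x)) (snd x))" for x
    unfolding h_def ansatz_def by (simp add: algebra_simps power2_eq_square)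
  show ?thesis
    unfolding eq using bigo_fst_sequentially[OF d, of K]
    by (intro bigo_mult_bounded bigo_one_intros wave_bigo t_bigo) simp_all
qed

text \<open>Each group of the decomposition contains one factor controlled by the cubic amplitude or
  by \<open>q\<close>; all other factors are bounded uniformly on \<open>K\<close>.\<close>

lemma residual_bigo:
  "(\<lambda>x. residual (fst x) (snd x)) \<in> O[UF](\<lambda>x. complex_of_real (t (Suc (fst x)) ^ 3 + \<bar>q (Suc (fst x))\<bar>))"
proof -
  define T where "T x = complex_of_real (t (Suc (fst x)))" for x :: "nat \<times> complex"
  define G where "G x = complex_of_real (t (Suc (fst x)) ^ 3 + \<bar>q (Suc (fst x))\<bar>)" for x :: "nat \<times> complex"
  have T1: "T \<in> O[UF](\<lambda>_. 1)" unfolding T_def by (rule t_bigo)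
  have TG: "f \<in> O[UF](G)" if "f \<in> O[UF](\<lambda>x. T x ^ 3)" for f
  proof (rule landau_o.big_trans[OF that])
    show "(\<lambda>x. T x ^ 3) \<in> O[UF](G)"
      by (intro bigoI[of _ 1] always_eventually)
         (auto simp: T_def G_def t_def norm_power simp del: of_real_add of_real_power)
  qed
  have qG: "(\<lambda>x. complex_of_real (q (Suc (fst x)))) \<in> O[UF](G)"
    by (intro bigoI[of _ 1] always_eventually) (auto simp: G_def t_def simp del: of_real_add)
  note f = residual_factor_bigo[folded T_def, THEN TG]
  have sh: "(\<lambda>x. h (Suc (Suc (fst x))) (snd x) - ansatz (T x) (Suc (Suc (fst x))) (snd x)) \<in> O[UF](G)"
      "(\<lambda>x. h (fst x) (snd x) - ansatz (T x) (fst x) (snd x)) \<in> O[UF](G)"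
    using ansatz_shift_bigo[of "\<lambda>n. Suc (Suc n)"] ansatz_shift_bigo[of "\<lambda>n. n"]
      powr_shift_up_bigo[OF gamma] powr_shift_down_bigo[OF gamma] TG
    by (auto simp: t_def T_def)
  note bnd = bigo_one_intros coeffs_bigo h_bigo wave_bigo e_power_bigo T1
  have c1: "(\<lambda>x. (ratio (Suc (fst x)) (snd x) - 1 + mu2 c \<omega> (snd x) * (T x)\<^sup>2)
      * (snd x * h (Suc (Suc (fst x))) (snd x))) \<in> O[UF](G)"
    by (intro bigo_mult_bounded f bnd)
  have c2: "(\<lambda>x. (1 / ratio (fst x) (snd x) - 1 - mu2 c \<omega> (snd x) * (T x)\<^sup>2)
      * (h (fst x) (snd x) * (1 / snd x))) \<in> O[UF](G)"
    by (intro bigo_mult_bounded f bnd)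
  have c3: "(\<lambda>x. (h (Suc (Suc (fst x))) (snd x) - ansatz (T x) (Suc (Suc (fst x))) (snd x))
      * (snd x * (1 - mu2 c \<omega> (snd x) * (T x)\<^sup>2))) \<in> O[UF](G)"
    by (intro bigo_mult_bounded sh bnd)
  have c4: "(\<lambda>x. (h (fst x) (snd x) - ansatz (T x) (fst x) (snd x))
      * ((1 + mu2 c \<omega> (snd x) * (T x)\<^sup>2) * (1 / snd x))) \<in> O[UF](G)"
    by (intro bigo_mult_bounded sh bnd)
  have c5: "(\<lambda>x. q (Suc (fst x)) * h (Suc (fst x)) (snd x)) \<in> O[UF](G)"
    by (intro bigo_mult_bounded qG bnd)
  have c6: "(\<lambda>x. T x ^ 3 * (- snd x * mu2 c \<omega> (snd x)
          * (wave1 (Suc (Suc (fst x))) (snd x) + T x * wave2 (Suc (Suc (fst x))) (snd x))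
        + mu2 c \<omega> (snd x) * (wave1 (fst x) (snd x) + T x * wave2 (fst x) (snd x)) * (1 / snd x)
        + (cp * e ^ Suc (fst x) + cm * (1 / e ^ Suc (fst x))) * wave2 (Suc (fst x)) (snd x))) \<in> O[UF](G)"
    by (intro TG bigo_mult_bounded bnd) simp
  note sum = sum_in_bigo(1)[OF sum_in_bigo(1)[OF sum_in_bigo(1)[OF sum_in_bigo(1)[OF sum_in_bigo(1)[OF c1 c2] c3] c4] c5] c6]
  \<comment> \<open>The decomposition is available only on the domain, so the residual is replaced
    by it only eventually along the filter.\<close>
  have ev: "\<forall>\<^sub>F x in UF. snd x \<in> jost_domain \<omega>"
    using K(2) by (auto simp: eventually_prod_sequentially_principal)
  have "(\<lambda>x. residual (fst x) (snd x)) \<in> O[UF](G)"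
    by (rule iffD2[OF landau_o.big.in_cong sum], rule eventually_mono[OF ev])
       (subst residual_decomposition, assumption, simp only: T_def mult_ac)
  then show ?thesis by (simp add: G_def[abs_def])
qed

lemma t_tendsto:
  assumes "filterlim f at_top sequentially"
  shows "((\<lambda>x. complex_of_real (t (f (fst x)))) \<longlongrightarrow> 0) UF"
proof -
  have "(\<lambda>n. complex_of_real (t n)) \<longlonglongrightarrow> of_real 0"
    unfolding t_def using gamma
    by (intro tendsto_of_real tendsto_neg_powr filterlim_real_sequentially) auto
  from filterlim_compose[OF filterlim_compose[OF this assms] filterlim_fst] show ?thesis by simp
qed

lemma h_tendsto:
  assumes "filterlim f at_top sequentially"
  shows "((\<lambda>x. h (f (fst x)) (snd x)) \<longlongrightarrow> 1) UF"
proof -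
  have "(\<lambda>x. complex_of_real (t (f (fst x)))) \<in> o[UF](\<lambda>_. 1)"
    using t_tendsto[OF assms] by (intro smalloI_tendsto) auto
  then have "(\<lambda>x. complex_of_real (t (f (fst x))) * (wave1 (f (fst x)) (snd x)
      + complex_of_real (t (f (fst x))) * wave2 (f (fst x)) (snd x))) \<in> o[UF](\<lambda>_. 1 * 1)"
    by (rule landau_o.small_big_mult) (intro bigo_one_intros wave_bigo t_bigo)
  then have "((\<lambda>x. complex_of_real (t (f (fst x))) * (wave1 (f (fst x)) (snd x)
      + complex_of_real (t (f (fst x))) * wave2 (f (fst x)) (snd x))) \<longlongrightarrow> 0) UF"
    by (auto dest: smalloD_tendsto)
  then have "((\<lambda>x. 1 + complex_of_real (t (f (fst x))) * (wave1 (f (fst x)) (snd x)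
      + complex_of_real (t (f (fst x))) * wave2 (f (fst x)) (snd x))) \<longlongrightarrow> 1 + 0) UF"
    by (intro tendsto_intros)
  then show ?thesis
    by (simp add: h_def ansatz_def algebra_simps power2_eq_square)
qed

text \<open>The estimate for the reciprocal is the starting point because it carries the unshifted
  index.\<close>

lemma ratio_tendsto: "((\<lambda>x. ratio (fst x) (snd x)) \<longlongrightarrow> 1) UF"
proof -
  have T: "((\<lambda>x. complex_of_real (t (Suc (fst x))))  \<longlongrightarrow> 0) UF"
    by (rule t_tendsto) (rule filterlim_Suc)
  then have "(\<lambda>x. complex_of_real (t (Suc (fst x)))) \<in> o[UF](\<lambda>_. 1)"
    by (intro smalloI_tendsto) auto
  then have small: "f \<in> o[UF](\<lambda>_. 1)"
    if "f \<in> O[UF](\<lambda>x. complex_of_real (t (Suc (fst x))) * 1)" for f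
    using that landau_o.big_small_trans by fastforce
  have "(\<lambda>x. complex_of_real (t (Suc (fst x))) ^ 3) \<in> O[UF](\<lambda>x. complex_of_real (t (Suc (fst x))) * 1)"
    unfolding power3_eq_cube mult.assoc
    by (intro landau_o.big.mult landau_o.big_refl bigo_one_intros t_bigo)
  note cubic = landau_o.big_trans[OF residual_factor_bigo(2) this]
  have "(\<lambda>x. complex_of_real (t (Suc (fst x))) * (mu2 c \<omega> (snd x) * complex_of_real (t (Suc (fst x)))))
     \<in> O[UF](\<lambda>x. complex_of_real (t (Suc (fst x))) * 1)"
    by (intro landau_o.big.mult landau_o.big_refl bigo_one_intros coeffs_bigo t_bigo)
  note this = sum_in_bigo(1)[OF cubic this]
  from small[OF this] have "(\<lambda>x. 1 / ratio (fst x) (snd x) - 1) \<in> o[UF](\<lambda>_. 1)"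
    by (simp add: algebra_simps power2_eq_square)
  then have "((\<lambda>x. 1 / ratio (fst x) (snd x) - 1) \<longlongrightarrow> 0) UF"
    by (auto dest: smalloD_tendsto)
  then have "((\<lambda>x. 1 / (1 + (1 / ratio (fst x) (snd x) - 1))) \<longlongrightarrow> 1 / (1 + 0)) UF"
    by (intro tendsto_intros) auto
  then show ?thesis by simp
qed

end

section \<open>Convergence of the Wronskian\<close>

definition p :: "nat \<Rightarrow> complex \<Rightarrow> complex" where
  "p n z = poly (jacobi_poly b n) (z + 1 / z)"
text \<open>The Wronskian \<open>J n * p (n + 1) - J (n + 1) * p n\<close> of \<open>J n = z ^ n * growth n z * h n z\<close> with \<open>p\<close>.\<close>

definition W :: "nat \<Rightarrow> complex \<Rightarrow> complex" where
  "W n z = z ^ n * growth n z * (h n z * p (Suc n) z - z * ratio n z * h (Suc n) z * p n z)"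
text \<open>The polynomial stripped of its expected growth; in the disc it converges to
  \<open>z * F z / (1 - z\<^sup>2)\<close>.\<close>

definition y :: "nat \<Rightarrow> complex \<Rightarrow> complex" where
  "y n z = z ^ n * growth n z * p n z"

lemma p_simps:
  "p 0 z = 0" "p (Suc 0) z = 1"
  "p (Suc (Suc n)) z = (z + 1 / z - b (Suc n)) * p (Suc n) z - p n z"
  by (simp_all add: p_def algebra_simps)

lemma growth_Suc: "growth (Suc n) z = ratio n z * growth n z"
  by (simp add: growth_def ratio_def algebra_simps flip: exp_add)

lemma ratio_nz: "ratio n z \<noteq> 0" and growth_nz: "growth n z \<noteq> 0"
  by (simp_all add: ratio_def growth_def)

text \<open>A Wronskian of two exact solutions would be constant. Since \<open>p\<close> solves the
  recurrence exactly, only the residual of the approximate solution survives.\<close>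

lemma W_step:
  assumes "z \<noteq> 0"
  shows "W (Suc n) z - W n z = - y (Suc n) z * residual n z"
proof -
  define g where "g = z ^ n * growth n z"
  have "W (Suc n) z - W n z = - (z * ratio n z * g) * p (Suc n) z *
     (z * ratio (Suc n) z * h (Suc (Suc n)) z + h n z / (ratio n z * z)
     - (z + 1 / z - b (Suc n)) * h (Suc n) z)"
    unfolding W_def p_simps growth_Suc power_Suc g_def using assms ratio_nz[of n z]
    by (simp add: field_simps)
  then show ?thesis unfolding y_def residual_def growth_Suc g_def by simp
qed

text \<open>The definition of \<open>W\<close> is solved for \<open>p (Suc n)\<close>. The
  multiplier of \<open>y n z\<close> tends to \<open>z\<^sup>2\<close>, hence contracts inside the
  disc.\<close>

lemma y_Suc:
  assumes "z \<noteq> 0" "h n z \<noteq> 0"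
  shows "y (Suc n) z = z\<^sup>2 * ((ratio n z)\<^sup>2 * h (Suc n) z / h n z) * y n z
    + W n z * (z * (ratio n z / h n z))"
  unfolding W_def y_def growth_Suc power_Suc using assms
  by (simp add: field_simps power2_eq_square)

lemma holomorphic_W_y:
  "W n holomorphic_on jost_domain \<omega>" "y n holomorphic_on jost_domain \<omega>"
proof -
  have p: "p n holomorphic_on jost_domain \<omega>" for n
  proof (induction n rule: induct_nat_012)
    case 0 then show ?case by (simp add: p_simps[abs_def])
  next
    case 1 then show ?case by (simp add: p_simps[abs_def])
  next
    case (ge2 n)
    then show ?case unfolding p_simps[abs_def]
      by (auto intro!: holomorphic_intros dest: jost_domainD)
  qed
  have h: "h n holomorphic_on jost_domain \<omega>" for n
    unfolding h_def[abs_def] ansatz_def wave1_def wave2_def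
    by (intro holomorphic_intros holomorphic_coeffs)
  have g: "ratio n holomorphic_on jost_domain \<omega>" "growth n holomorphic_on jost_domain \<omega>" for n
    unfolding ratio_def[abs_def] growth_def[abs_def]
    by (intro holomorphic_intros holomorphic_coeffs)+
  show "W n holomorphic_on jost_domain \<omega>" "y n holomorphic_on jost_domain \<omega>"
    unfolding W_def[abs_def] y_def[abs_def]
    by (intro holomorphic_intros p h g)+
qed

text \<open>By \<open>W_step\<close>, control of \<open>y\<close> by a majorant \<open>M\<close>
  controls the increments of \<open>W\<close>, with coefficients summable because
  \<open>3 * \<gamma> > 1\<close>. This is the common part of the disc and circle arguments, which
  differ in the choice of \<open>M\<close>.\<close>

lemma W_uniform_limit:
  fixes M :: "nat \<Rightarrow> complex \<Rightarrow> real"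
  assumes K: "compact K" "K \<subseteq> jost_domain \<omega>"
    and A: "A \<ge> 0"
    and y: "\<And>n z. n \<ge> N \<Longrightarrow> z \<in> K \<Longrightarrow> norm (y (Suc n) z) \<le> A * M n z"
    and M: "\<And>n z. n \<ge> N \<Longrightarrow> z \<in> K \<Longrightarrow> M (Suc n) z \<le> M n z + norm (W (Suc n) z - W n z)"
    and M0: "\<And>n z. 0 \<le> M n z" and bdd: "\<And>n. continuous_on K (M n)"
  obtains F B N' where "uniform_limit K W F sequentially"
    "\<And>n z. n \<ge> N' \<Longrightarrow> z \<in> K \<Longrightarrow> M n z \<le> B"
proof -
  obtain C where C: "C > 0" "\<forall>\<^sub>F x in sequentially \<times>\<^sub>F principal K. norm (residual (fst x) (snd x)) \<le>
      C * norm (complex_of_real (t (Suc (fst x)) ^ 3 + \<bar>q (Suc (fst x))\<bar>))"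
    using residual_bigo[OF K] by (elim landau_o.bigE)
  then obtain N1 where N1: "\<And>n z. n \<ge> N1 \<Longrightarrow> z \<in> K \<Longrightarrow>
      norm (residual n z) \<le> C * (t (Suc n) ^ 3 + \<bar>q (Suc n)\<bar>)"
    unfolding eventually_prod_sequentially_principal
    by (auto simp: t_def norm_of_real simp del: of_real_add of_real_power)
  define N' where "N' = max N N1"
  define \<epsilon> where "\<epsilon> n = A * C * (t (Suc n) ^ 3 + \<bar>q (Suc n)\<bar>)" for n
  have \<epsilon>0: "\<epsilon> n \<ge> 0" for n using A C by (simp add: \<epsilon>_def t_def)
  have "summable (\<lambda>n. real n powr (- (3 * \<gamma>)))"
    using gamma by (simp add: summable_real_powr_iff)
  moreover have "t n ^ 3 = real n powr (- (3 * \<gamma>))" for n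
    by (cases "n = 0") (auto simp: t_def powr_power)
  ultimately have "summable (\<lambda>n. t n ^ 3)" by simp
  then have \<epsilon>s: "summable \<epsilon>"
    unfolding \<epsilon>_def using q_summable
    by (intro summable_mult summable_add) (simp_all add: summable_Suc_iff[of "\<lambda>n. t n ^ 3"] summable_Suc_iff[of "\<lambda>n. \<bar>q n\<bar>"])
  have WM: "norm (W (Suc n) z - W n z) \<le> \<epsilon> n * M n z" if "n \<ge> N'" "z \<in> K" for n z
  proof -
    have "z \<noteq> 0" using K that jost_domainD(1) by blast
    then have "norm (W (Suc n) z - W n z) = norm (y (Suc n) z) * norm (residual n z)"
      by (simp add: W_step norm_mult)
    also have "\<dots> \<le> (A * M n z) * (C * (t (Suc n) ^ 3 + \<bar>q (Suc n)\<bar>))"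
      using y[of n z] N1[of n z] A M0[of n z] that by (intro mult_mono) (auto simp: N'_def)
    finally show ?thesis by (simp add: \<epsilon>_def mult_ac)
  qed
  have MM: "M (Suc n) z \<le> (1 + \<epsilon> n) * M n z" if "n \<ge> N'" "z \<in> K" for n z
    using M[of n z] WM[of n z] that by (simp add: N'_def algebra_simps)
  obtain B0 where "\<And>z. z \<in> K \<Longrightarrow> norm (M N' z) \<le> B0"
    using compact_imp_bounded[OF compact_continuous_image[OF bdd[of N'] K(1)]]
    unfolding bounded_iff by blast
  then have B0: "0 \<le> M N' z \<and> M N' z \<le> B0" if "z \<in> K" for z
    using M0[of N' z] that by force
  show ?thesis
  proof (rule uniform_limit_of_gronwall[of \<epsilon> N' K W M B0])
    fix F B' assume "uniform_limit K W F sequentially" "\<And>n z. N' \<le> n \<Longrightarrow> z \<in> K \<Longrightarrow> M n z \<le> B'"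
    then show thesis by (rule that)
  qed (fact \<epsilon>0 \<epsilon>s WM MM B0)+
qed

lemma eventually_h_ratio:
  assumes K: "compact K" "K \<subseteq> jost_domain \<omega>" and "\<eta> > 0"
  obtains N where "\<And>n z. n \<ge> N \<Longrightarrow> z \<in> K \<Longrightarrow> h n z \<noteq> 0"
    "\<And>n z. n \<ge> N \<Longrightarrow> z \<in> K \<Longrightarrow> norm (h n z - 1) < \<eta>"
    "\<And>n z. n \<ge> N \<Longrightarrow> z \<in> K \<Longrightarrow> norm (ratio n z * h (Suc n) z - 1) < \<eta>"
    "\<And>n z. n \<ge> N \<Longrightarrow> z \<in> K \<Longrightarrow> norm (ratio n z / h n z - 1) < \<eta>"
    "\<And>n z. n \<ge> N \<Longrightarrow> z \<in> K \<Longrightarrow> norm ((ratio n z)\<^sup>2 * h (Suc n) z / h n z - 1) < \<eta>"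
proof -
  let ?F = "sequentially \<times>\<^sub>F principal K"
  have h: "((\<lambda>x. h (fst x) (snd x)) \<longlongrightarrow> 1) ?F" "((\<lambda>x. h (Suc (fst x)) (snd x)) \<longlongrightarrow> 1) ?F"
    using h_tendsto[OF K filterlim_ident] h_tendsto[OF K filterlim_Suc] by auto
  note r = ratio_tendsto[OF K]
  have ev: "\<forall>\<^sub>F x in ?F. norm (f x - 1) < \<eta>" if "(f \<longlongrightarrow> 1) ?F" for f :: "_ \<Rightarrow> complex"
    using tendstoD[OF that \<open>\<eta> > 0\<close>] by (simp add: dist_norm)
  have "\<forall>\<^sub>F x in ?F. h (fst x) (snd x) \<noteq> 0"
    using tendsto_imp_eventually_ne[OF h(1)] by simp
  moreover have "\<forall>\<^sub>F x in ?F. norm (h (fst x) (snd x) - 1) < \<eta>"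
    by (rule ev) fact
  moreover have "\<forall>\<^sub>F x in ?F. norm (ratio (fst x) (snd x) * h (Suc (fst x)) (snd x) - 1) < \<eta>"
    using tendsto_mult[OF r h(2)] by (intro ev) simp
  moreover have "\<forall>\<^sub>F x in ?F. norm (ratio (fst x) (snd x) / h (fst x) (snd x) - 1) < \<eta>"
    using tendsto_divide[OF r h(1)] by (intro ev) simp
  moreover have "\<forall>\<^sub>F x in ?F. norm ((ratio (fst x) (snd x))\<^sup>2 * h (Suc (fst x)) (snd x) / h (fst x) (snd x) - 1) < \<eta>"
    using tendsto_divide[OF tendsto_mult[OF tendsto_power[OF r] h(2)] h(1)] by (intro ev) simp
  ultimately have "\<forall>\<^sub>F x in ?F. h (fst x) (snd x) \<noteq> 0 \<and> norm (h (fst x) (snd x) - 1) < \<eta> \<and>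
     norm (ratio (fst x) (snd x) * h (Suc (fst x)) (snd x) - 1) < \<eta> \<and>
     norm (ratio (fst x) (snd x) / h (fst x) (snd x) - 1) < \<eta> \<and>
     norm ((ratio (fst x) (snd x))\<^sup>2 * h (Suc (fst x)) (snd x) / h (fst x) (snd x) - 1) < \<eta>"
    by (intro eventually_conj)
  then show ?thesis
    unfolding eventually_prod_sequentially_principal using that by auto
qed

text \<open>The uniform limits are specialised to the compact set \<open>{z}\<close>.\<close>

lemma h_ratio_tendsto_pointwise:
  assumes "z \<in> jost_domain \<omega>"
  shows "(\<lambda>n. h n z) \<longlonglongrightarrow> 1" "(\<lambda>n. ratio n z) \<longlonglongrightarrow> 1"
proof -
  have "filterlim (\<lambda>n. (n, z)) (sequentially \<times>\<^sub>F principal {z}) sequentially"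
    by (auto simp: filterlim_iff eventually_prod_sequentially_principal eventually_sequentially)
  note lim = filterlim_compose[OF _ this]
  show "(\<lambda>n. h n z) \<longlonglongrightarrow> 1" "(\<lambda>n. ratio n z) \<longlonglongrightarrow> 1"
    using lim[OF h_tendsto[OF _ _ filterlim_ident]] lim[OF ratio_tendsto] assms by auto
qed

section \<open>Convergence inside the punctured disc\<close>

lemma ball_subset_jost_domain: "ball 0 1 - {0} \<subseteq> jost_domain \<omega>"
  by (auto simp: jost_domain_def)

text \<open>The recurrence \<open>y_Suc\<close> eventually contracts with factor
  \<open>\<rho>\<close>, so \<open>y\<close> is governed by \<open>W\<close>; the majorant is the
  maximum of the norm of \<open>W\<close> and a rescaled norm of \<open>y\<close>.\<close>

lemma W_uniform_limit_disc:
  assumes K: "compact K" "K \<subseteq> ball 0 1 - {0}" and \<rho>: "\<And>z. z \<in> K \<Longrightarrow> norm z \<le> \<rho>" "0 < \<rho>" "\<rho> < 1"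
  obtains F where "uniform_limit K W F sequentially"
proof -
  have KU: "K \<subseteq> jost_domain \<omega>" using K ball_subset_jost_domain by blast
  \<comment> \<open>The bound \<open>1 / \<rho> - 1\<close> reduces the multiplier estimate
    \<open>\<rho>\<^sup>2 * (1 + \<eta>)\<close> to at most \<open>\<rho>\<close>; the bound 1 gives
    the factor 2 in front of \<open>W\<close>.\<close>
  define \<eta> where "\<eta> = min 1 (1 / \<rho> - 1)"
  have "\<eta> \<le> 1 / \<rho> - 1" by (simp add: \<eta>_def)
  then have \<eta>: "\<eta> > 0" "\<eta> \<le> 1" "1 + \<eta> \<le> 1 / \<rho>" using \<rho> by (auto simp: \<eta>_def)
  obtain N where N: "\<And>n z. n \<ge> N \<Longrightarrow> z \<in> K \<Longrightarrow> h n z \<noteq> 0"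
    "\<And>n z. n \<ge> N \<Longrightarrow> z \<in> K \<Longrightarrow> norm (ratio n z / h n z - 1) < \<eta>"
    "\<And>n z. n \<ge> N \<Longrightarrow> z \<in> K \<Longrightarrow> norm ((ratio n z)\<^sup>2 * h (Suc n) z / h n z - 1) < \<eta>"
    using eventually_h_ratio[OF K(1) KU \<eta>(1)] by metis
  have le: "norm x \<le> 1 + \<eta>" if "norm (x - 1) < \<eta>" for x :: complex
    using that norm_triangle_ineq[of "x - 1" 1] by simp
  have yb: "norm (y (Suc n) z) \<le> \<rho> * norm (y n z) + 2 * norm (W n z)" if "n \<ge> N" "z \<in> K" for n z
  proof -
    have z: "z \<noteq> 0" "norm z \<le> \<rho>" using that K \<rho> by auto
    have "norm (z\<^sup>2 * ((ratio n z)\<^sup>2 * h (Suc n) z / h n z)) = (norm z)\<^sup>2 * norm ((ratio n z)\<^sup>2 * h (Suc n) z / h n z)"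
      by (simp only: norm_mult norm_power)
    also have "\<dots> \<le> \<rho>\<^sup>2 * (1 / \<rho>)"
      using z le[OF N(3)[OF that]] \<eta>(3) by (intro mult_mono power_mono) auto
    also have "\<dots> = \<rho>" using \<rho> by (simp add: power2_eq_square)
    finally have a: "norm (z\<^sup>2 * ((ratio n z)\<^sup>2 * h (Suc n) z / h n z)) \<le> \<rho>" .
    have "norm (z * (ratio n z / h n z)) \<le> 1 * 2"
      unfolding norm_mult using z \<rho> le[OF N(2)[OF that]] \<eta>(2) by (intro mult_mono) auto
    then have d: "norm (z * (ratio n z / h n z)) \<le> 2" by simp
    have "norm (y (Suc n) z) \<le> norm (z\<^sup>2 * ((ratio n z)\<^sup>2 * h (Suc n) z / h n z)) * norm (y n z)
        + norm (W n z) * norm (z * (ratio n z / h n z))"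
      unfolding y_Suc[OF z(1) N(1)[OF that]] norm_mult[symmetric] by (rule norm_triangle_ineq)
    also have "\<dots> \<le> \<rho> * norm (y n z) + norm (W n z) * 2"
      using a d by (intro add_mono mult_left_mono mult_right_mono) auto
    finally show ?thesis by simp
  qed
  \<comment> \<open>This scaling makes the bound on \<open>\<kappa> * norm (y (Suc n) z)\<close> a
    convex combination with weights \<open>\<rho>\<close> and \<open>1 - \<rho>\<close>.\<close>
  define \<kappa> where "\<kappa> = (1 - \<rho>) / 2"
  have \<kappa>: "\<kappa> > 0" using \<rho> by (simp add: \<kappa>_def)
  define M where "M n z = max (norm (W n z)) (\<kappa> * norm (y n z))" for n z
  have key: "\<kappa> * norm (y (Suc n) z) \<le> M n z" if "n \<ge> N" "z \<in> K" for n z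
  proof -
    have "\<kappa> * norm (y (Suc n) z) \<le> \<kappa> * (\<rho> * norm (y n z) + 2 * norm (W n z))"
      using yb[OF that] \<kappa> by simp
    also have "\<dots> = \<rho> * (\<kappa> * norm (y n z)) + (1 - \<rho>) * norm (W n z)"
      by (simp add: \<kappa>_def field_simps)
    also have "\<dots> \<le> \<rho> * M n z + (1 - \<rho>) * M n z"
      using \<rho> by (intro add_mono mult_left_mono) (auto simp: M_def)
    finally show ?thesis by (simp add: algebra_simps)
  qed
  have cont: "continuous_on K (W n)" "continuous_on K (y n)" for n
    using holomorphic_W_y KU by (blast intro: holomorphic_on_imp_continuous_on holomorphic_on_subset)+
  show ?thesis
  proof (rule W_uniform_limit[OF K(1) KU, of "1 / \<kappa>" N M])
    show "norm (y (Suc n) z) \<le> 1 / \<kappa> * M n z" if "n \<ge> N" "z \<in> K" for n z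
      using key[OF that] \<kappa> by (simp add: field_simps)
    show "M (Suc n) z \<le> M n z + norm (W (Suc n) z - W n z)" if "n \<ge> N" "z \<in> K" for n z
    proof -
      have "norm (W (Suc n) z) \<le> M n z + norm (W (Suc n) z - W n z)"
        using norm_triangle_ineq[of "W n z" "W (Suc n) z - W n z"] by (simp add: M_def)
      moreover have "\<kappa> * norm (y (Suc n) z) \<le> M n z + norm (W (Suc n) z - W n z)"
        using key[OF that] by (simp add: add_increasing2)
      ultimately show ?thesis by (simp add: M_def)
    qed
    show "continuous_on K (M n)" for n
      unfolding M_def[abs_def] by (intro continuous_intros cont)
  qed (use \<kappa> that in \<open>auto simp: M_def le_max_iff_disj\<close>)
qed

section \<open>The unit circle\<close>

lemma cnj_eq_inverse_of_unit: "norm z = 1 \<Longrightarrow> cnj z = 1 / z"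
  using complex_norm_square[of z] by (cases "z = 0") (auto simp: field_simps)

text \<open>On the circle \<open>z + 1 / z\<close> is real, and so are the coefficients of the
  recurrence.\<close>

lemma cnj_p:
  assumes "norm z = 1"
  shows "cnj (p n z) = p n z"
proof -
  have "cnj z = 1 / z" using assms by (simp add: cnj_eq_inverse_of_unit)
  then have real: "cnj (z + 1 / z) = z + 1 / z" by (simp add: field_simps)
  show ?thesis
  proof (induction n rule: induct_nat_012)
    case (ge2 n)
    have "cnj (p (Suc (Suc n)) z) = (cnj (z + 1 / z) - b (Suc n)) * cnj (p (Suc n) z) - cnj (p n z)"
      by (simp add: p_simps)
    then show ?case using ge2 unfolding real by (simp add: p_simps)
  qed (simp_all add: p_simps)
qed

text \<open>Conjugation inverts \<open>z\<close> and \<open>e\<close>, which changes the sign of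
  \<open>mu2\<close>. Hence \<open>growth\<close> is unimodular on the circle.\<close>

lemma Re_mu2_circle:
  assumes "norm z = 1"
  shows "Re (mu2 c \<omega> z) = 0"
\<comment> \<open>At these points a denominator vanishes and division by zero gives the value
  0.\<close>
proof (cases "z\<^sup>2 = 1 \<or> z\<^sup>2 = e \<or> z\<^sup>2 * e = 1")
  case True
  then show ?thesis by (auto simp: mu2_def e_def)
next
  case False
  have inv: "cnj z = 1 / z" "cnj e = 1 / e"
    using assms norm_e by (simp_all add: cnj_eq_inverse_of_unit)
  have z: "z \<noteq> 0" using assms by auto
  have mu: "mu2 c \<omega> z = (complex_of_real c)\<^sup>2 * z\<^sup>2 * (1 + z\<^sup>2) * e /
       (4 * (1 - z\<^sup>2) * (z\<^sup>2 - e) * (1 - z\<^sup>2 * e))" by (simp add: mu2_def e_def)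
  have nz: "1 - z\<^sup>2 \<noteq> 0" "z\<^sup>2 - e \<noteq> 0" "1 - z\<^sup>2 * e \<noteq> 0" "z\<^sup>2 - 1 \<noteq> 0" "e - z\<^sup>2 \<noteq> 0" "z\<^sup>2 * e - 1 \<noteq> 0"
    using False by auto
  have "cnj (mu2 c \<omega> z) = (complex_of_real c)\<^sup>2 * (1 / z)\<^sup>2 * (1 + (1 / z)\<^sup>2) * (1 / e) /
       (4 * (1 - (1 / z)\<^sup>2) * ((1 / z)\<^sup>2 - 1 / e) * (1 - (1 / z)\<^sup>2 * (1 / e)))"
    by (simp add: mu inv)
  also have "1 - (1 / z)\<^sup>2 = (z\<^sup>2 - 1) / z\<^sup>2" using z by (simp add: field_simps)
  also have "(1 / z)\<^sup>2 - 1 / e = (e - z\<^sup>2) / (z\<^sup>2 * e)" using z e_nz by (simp add: field_simps)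
  also have "1 - (1 / z)\<^sup>2 * (1 / e) = (z\<^sup>2 * e - 1) / (z\<^sup>2 * e)" using z e_nz by (simp add: field_simps)
  also have "1 + (1 / z)\<^sup>2 = (1 + z\<^sup>2) / z\<^sup>2" using z by (simp add: field_simps)
  also have "(complex_of_real c)\<^sup>2 * (1 / z)\<^sup>2 * ((1 + z\<^sup>2) / z\<^sup>2) * (1 / e) /
       (4 * ((z\<^sup>2 - 1) / z\<^sup>2) * ((e - z\<^sup>2) / (z\<^sup>2 * e)) * ((z\<^sup>2 * e - 1) / (z\<^sup>2 * e)))
      = (complex_of_real c)\<^sup>2 * z\<^sup>2 * (1 + z\<^sup>2) * e / (4 * (z\<^sup>2 - 1) * (e - z\<^sup>2) * (z\<^sup>2 * e - 1))"
    using z e_nz nz by (simp add: divide_simps power2_eq_square)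
  also have "4 * (z\<^sup>2 - 1) * (e - z\<^sup>2) * (z\<^sup>2 * e - 1) = - (4 * (1 - z\<^sup>2) * (z\<^sup>2 - e) * (1 - z\<^sup>2 * e))"
    by (simp add: algebra_simps)
  finally have "cnj (mu2 c \<omega> z) = - mu2 c \<omega> z" unfolding mu by (simp only: divide_minus_right)
  then have "Re (cnj (mu2 c \<omega> z)) = Re (- mu2 c \<omega> z)" by simp
  then show ?thesis by simp
qed

lemma norm_growth_circle: "norm z = 1 \<Longrightarrow> norm (growth n z) = 1"
  by (simp add: growth_def norm_exp_eq_Re Re_mu2_circle)

text \<open>As \<open>p\<close> is real, \<open>X n\<close> and its conjugate are two linear
  equations for \<open>p n z\<close> and \<open>p (Suc n) z\<close>, with a determinant that is
  nonzero away from \<open>z = \<plusminus>1\<close>.\<close>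

lemma p_eq_circle:
  assumes "norm z = 1" "z\<^sup>2 \<noteq> 1"
  defines "X \<equiv> \<lambda>n. p (Suc n) z - z * p n z"
  shows "p n z = z / (1 - z\<^sup>2) * (X n - cnj (X n))"
    and "p (Suc n) z = z / (1 - z\<^sup>2) * (X n / z - z * cnj (X n))"
proof -
  have z: "z \<noteq> 0" "1 - z\<^sup>2 \<noteq> 0" using assms by auto
  have cX: "cnj (X n) = p (Suc n) z - p n z / z"
    using assms(1) by (simp add: X_def cnj_p cnj_eq_inverse_of_unit divide_inverse)
  show "p n z = z / (1 - z\<^sup>2) * (X n - cnj (X n))"
    unfolding cX unfolding X_def using z by (simp add: field_simps power2_eq_square)
  show "p (Suc n) z = z / (1 - z\<^sup>2) * (X n / z - z * cnj (X n))"
    unfolding cX unfolding X_def using z by (simp add: field_simps power2_eq_square)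
qed

text \<open>There is no contraction here. Instead \<open>X\<close>, the Wronskian with the free
  solution up to a unimodular factor, bounds \<open>p\<close>, and \<open>W\<close> bounds
  \<open>X\<close> once \<open>h\<close> and \<open>ratio\<close> are close to 1; thus the norm of
  \<open>W\<close> is its own majorant.\<close>

lemma W_uniform_limit_circle:
  assumes K: "compact K" "K \<subseteq> sphere 0 1 \<inter> jost_domain \<omega>"
  obtains F B N where "uniform_limit K W F sequentially"
    "\<And>n z. n \<ge> N \<Longrightarrow> z \<in> K \<Longrightarrow> norm (p n z) \<le> B"
proof -
  have KU: "K \<subseteq> jost_domain \<omega>" and K1: "\<And>z. z \<in> K \<Longrightarrow> norm z = 1" using K by auto
  have sq: "z\<^sup>2 \<noteq> 1" if "z \<in> K" for z using that KU jost_domainD(2) by blast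
  have "continuous_on K (\<lambda>z. 1 / (1 - z\<^sup>2))"
    using sq by (intro continuous_intros) auto
  from compact_imp_bounded[OF compact_continuous_image[OF this K(1)]]
  obtain B where B: "B > 0" "\<And>z. z \<in> K \<Longrightarrow> norm (1 / (1 - z\<^sup>2)) \<le> B"
    unfolding bounded_pos by blast
  define X where "X n z = p (Suc n) z - z * p n z" for n z
  have pX: "norm (p n z) \<le> 2 * B * norm (X n z)" "norm (p (Suc n) z) \<le> 2 * B * norm (X n z)"
    if "z \<in> K" for n z
  proof -
    have *: "norm (z / (1 - z\<^sup>2) * (u - v)) \<le> 2 * B * norm (X n z)"
      if "norm u = norm (X n z)" "norm v = norm (X n z)" for u v
    proof -
      have "norm (z / (1 - z\<^sup>2) * (u - v)) = norm (1 / (1 - z\<^sup>2)) * norm (u - v)"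
        using K1[OF \<open>z \<in> K\<close>] by (simp add: norm_mult norm_divide)
      also have "\<dots> \<le> B * (2 * norm (X n z))"
        using B(2)[OF \<open>z \<in> K\<close>] B(1) norm_triangle_ineq4[of u v] that by (intro mult_mono) auto
      finally show ?thesis by simp
    qed
    have "p n z = z / (1 - z\<^sup>2) * (X n z - cnj (X n z))"
      "p (Suc n) z = z / (1 - z\<^sup>2) * (X n z / z - z * cnj (X n z))"
      using p_eq_circle[OF K1[OF that] sq[OF that], of n] by (simp_all only: X_def)
    then show "norm (p n z) \<le> 2 * B * norm (X n z)" "norm (p (Suc n) z) \<le> 2 * B * norm (X n z)"
      using *[of "X n z" "cnj (X n z)"] *[of "X n z / z" "z * cnj (X n z)"] K1[OF that]
      by (simp_all only: complex_mod_cnj norm_mult norm_divide mult_1 div_by_1)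
  qed
  \<comment> \<open>Each of the two errors in \<open>X - W\<close> type comparisons is then at most
    a quarter of the norm of \<open>X\<close>, so half of that norm is absorbed.\<close>
  define \<eta> where "\<eta> = 1 / (8 * B)"
  have \<eta>: "\<eta> > 0" using B by (simp add: \<eta>_def)
  obtain N where N: "\<And>n z. n \<ge> N \<Longrightarrow> z \<in> K \<Longrightarrow> norm (h n z - 1) < \<eta>"
    "\<And>n z. n \<ge> N \<Longrightarrow> z \<in> K \<Longrightarrow> norm (ratio n z * h (Suc n) z - 1) < \<eta>"
    using eventually_h_ratio[OF K(1) KU \<eta>] by metis
  have tri: "norm (u - v + w) \<le> norm u + norm v + norm w" for u v w :: complex
    using norm_triangle_ineq[of "u - v" w] norm_triangle_ineq4[of u v] by linarith
  have XW: "norm (X n z) \<le> 2 * norm (W n z)" if "n \<ge> N" "z \<in> K" for n z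
  proof -
    have "norm (W n z) = norm (h n z * p (Suc n) z - z * ratio n z * h (Suc n) z * p n z)"
      using K1[OF that(2)] by (simp add: W_def norm_mult norm_power norm_growth_circle)
    moreover have "X n z = (h n z * p (Suc n) z - z * ratio n z * h (Suc n) z * p n z)
        - (h n z - 1) * p (Suc n) z + z * (ratio n z * h (Suc n) z - 1) * p n z"
      by (simp add: X_def algebra_simps)
    ultimately have "norm (X n z) \<le> norm (W n z) + norm ((h n z - 1) * p (Suc n) z)
        + norm (z * (ratio n z * h (Suc n) z - 1) * p n z)"
      using tri by simp
    also have "norm ((h n z - 1) * p (Suc n) z) \<le> \<eta> * (2 * B * norm (X n z))"
      unfolding norm_mult using N(1)[OF that] pX(2)[OF that(2)] \<eta> by (intro mult_mono) auto
    also have "norm (z * (ratio n z * h (Suc n) z - 1) * p n z) \<le> \<eta> * (2 * B * norm (X n z))"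
      unfolding norm_mult using N(2)[OF that] pX(1)[OF that(2)] \<eta> K1[OF that(2)] by (intro mult_mono) auto
    finally show ?thesis using B by (simp add: \<eta>_def)
  qed
  have cont: "continuous_on K (W n)" for n
    using holomorphic_W_y KU by (blast intro: holomorphic_on_imp_continuous_on holomorphic_on_subset)
  have pW: "norm (p n z) \<le> 4 * B * norm (W n z)" "norm (p (Suc n) z) \<le> 4 * B * norm (W n z)"
    if "n \<ge> N" "z \<in> K" for n z
  proof -
    have "2 * B * norm (X n z) \<le> 2 * B * (2 * norm (W n z))"
      using XW[OF that] B by (intro mult_left_mono) auto
    then show "norm (p n z) \<le> 4 * B * norm (W n z)" "norm (p (Suc n) z) \<le> 4 * B * norm (W n z)"
      using pX[OF that(2), of n] by auto
  qed
  show ?thesis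
  proof (rule W_uniform_limit[OF K(1) KU, of "4 * B" N "\<lambda>n z. norm (W n z)"])
    show "norm (y (Suc n) z) \<le> 4 * B * norm (W n z)" if "n \<ge> N" "z \<in> K" for n z
      using pW(2)[OF that] K1[OF that(2)] by (simp add: y_def norm_mult norm_power norm_growth_circle)
    show "norm (W (Suc n) z) \<le> norm (W n z) + norm (W (Suc n) z - W n z)" for n z
      using norm_triangle_ineq[of "W n z" "W (Suc n) z - W n z"] by simp
    fix F B' N' assume F: "uniform_limit K W F sequentially"
      and B': "\<And>n z. n \<ge> N' \<Longrightarrow> z \<in> K \<Longrightarrow> norm (W n z) \<le> B'"
    have "norm (p n z) \<le> 4 * B * B'" if "n \<ge> max N N'" "z \<in> K" for n z
      using pW(1)[of n z] B'[of n z] that B(1)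
      by (intro order_trans[OF pW(1)] mult_left_mono) auto
    with F show ?thesis using that by blast
  qed (use B in \<open>auto intro!: continuous_intros cont\<close>)
qed

section \<open>The Jost function\<close>

text \<open>A pointwise limit, independent of any compact set; it carries information only where
  \<open>W n z\<close> converges.\<close>

definition F :: "complex \<Rightarrow> complex" where "F z = lim (\<lambda>n. W n z)"

text \<open>Uniqueness of limits glues the limits obtained on separate compact sets into one
  function.\<close>

lemma uniform_limit_F:
  assumes "uniform_limit K W G sequentially"
  shows "uniform_limit K W F sequentially"
proof -
  have "F z = G z" if "z \<in> K" for z
    using tendsto_uniform_limitI[OF assms that] by (simp add: F_def limI)
  then show ?thesis using assms uniform_limit_cong'[of K W W G F] by metis
qed

lemma F_analytic: "F analytic_on ball 0 1 - {0}"
proof -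
  have op: "open (ball 0 1 - {0::complex})" by auto
  have "F holomorphic_on ball 0 1 - {0}"
  proof (rule holomorphic_uniform_sequence[OF op])
    show "W n holomorphic_on ball 0 1 - {0}" for n
      using holomorphic_W_y(1) ball_subset_jost_domain holomorphic_on_subset by blast
    fix z :: complex assume z: "z \<in> ball 0 1 - {0}"
    \<comment> \<open>The first bound keeps the closed disc away from 0, the second keeps it within
      radius \<open>\<rho> < 1\<close>.\<close>
    define d where "d = min (norm z / 2) ((1 - norm z) / 2)"
    define \<rho> where "\<rho> = (1 + norm z) / 2"
    have "d \<le> norm z / 2" by (simp add: d_def)
    moreover have "norm z > 0" using z by simp
    ultimately have d: "d > 0" "d < norm z" using z by (simp add: d_def, linarith)
    have n: "norm w \<le> \<rho>" if "w \<in> cball z d" for w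
    proof -
      have "norm w \<le> norm z + d" using that norm_triangle_sub[of w z] by (simp add: dist_norm norm_minus_commute)
      also have "\<dots> \<le> norm z + (1 - norm z) / 2" by (simp only: d_def add_left_mono min.cobounded2)
      finally show ?thesis by (simp add: \<rho>_def field_simps)
    qed
    have \<rho>: "0 < \<rho>" "\<rho> < 1" using z by (auto simp: \<rho>_def add_pos_nonneg)
    have sub: "cball z d \<subseteq> ball 0 1 - {0}"
      using n \<rho> d by (force simp: dist_norm)
    obtain G where "uniform_limit (cball z d) W G sequentially"
      using W_uniform_limit_disc[OF compact_cball sub n \<rho>] by blast
    from uniform_limit_F[OF this] sub d(1)
    show "\<exists>d>0. cball z d \<subseteq> ball 0 1 - {0} \<and> uniform_limit (cball z d) W F sequentially" by blast
  qed
  then show ?thesis using analytic_on_open[OF op] by blast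
qed

lemma open_jost_domain: "open (jost_domain \<omega>)"
  unfolding jost_domain_def by (intro open_Compl finite_imp_closed) auto

text \<open>Uniform convergence is used only along the circle, so continuity is relative to it. It
  is obtained on compact pieces that are relative neighbourhoods.\<close>

lemma F_continuous: "continuous_on (sphere 0 1 \<inter> jost_domain \<omega>) F"
  unfolding continuous_on_eq_continuous_within
proof
  fix z assume z: "z \<in> sphere 0 1 \<inter> jost_domain \<omega>"
  then obtain d where d: "d > 0" "cball z d \<subseteq> jost_domain \<omega>"
    using open_jost_domain by (auto simp: open_contains_cball)
  define K where "K = sphere 0 1 \<inter> cball z d"
  have K: "compact K" "K \<subseteq> sphere 0 1 \<inter> jost_domain \<omega>" using d by (auto simp: K_def)
  obtain G where "uniform_limit K W G sequentially" using W_uniform_limit_circle[OF K] by metis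
  from uniform_limit_F[OF this] have "continuous_on K F"
    by (rule uniform_limit_theorem[rotated])
       (use K holomorphic_W_y(1) in \<open>auto intro!: always_eventually holomorphic_on_imp_continuous_on intro: holomorphic_on_subset\<close>)
  moreover have "z \<in> K" using z d by (simp add: K_def)
  ultimately have "continuous (at z within K) F"
    by (simp add: continuous_on_eq_continuous_within)
  moreover have "at z within (sphere 0 1 \<inter> jost_domain \<omega>) = at z within K"
    by (rule at_within_nhd[of z "ball z d"]) (use d z in \<open>auto simp: K_def\<close>)
  ultimately show "continuous (at z within sphere 0 1 \<inter> jost_domain \<omega>) F" by simp
qed

text \<open>In the affine recurrence for \<open>y\<close> the multiplier tends to
  \<open>z\<^sup>2\<close> and the inhomogeneity to \<open>z * F z\<close>.\<close>

lemma asymptotics_disc: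
  assumes z: "z \<in> ball 0 1 - {0}"
  shows "(\<lambda>n. y n z) \<longlonglongrightarrow> z * F z / (1 - z\<^sup>2)"
proof -
  have zU: "{z} \<subseteq> jost_domain \<omega>" using z ball_subset_jost_domain by blast
  have W: "(\<lambda>n. W n z) \<longlonglongrightarrow> F z"
  proof -
    obtain G where "uniform_limit {z} W G sequentially"
      by (rule W_uniform_limit_disc[of "{z}" "norm z"]) (use z in auto)
    from tendsto_uniform_limitI[OF uniform_limit_F[OF this]] show ?thesis by simp
  qed
  have zJ: "z \<in> jost_domain \<omega>" using zU by simp
  note lims = h_ratio_tendsto_pointwise[OF zJ] LIMSEQ_Suc[OF h_ratio_tendsto_pointwise(1)[OF zJ]]
  have "(\<lambda>n. (ratio n z)\<^sup>2 * h (Suc n) z / h n z) \<longlonglongrightarrow> 1\<^sup>2 * 1 / 1" "(\<lambda>n. ratio n z / h n z) \<longlonglongrightarrow> 1 / 1"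
    by (intro tendsto_intros lims; simp)+
  then have r: "(\<lambda>n. (ratio n z)\<^sup>2 * h (Suc n) z / h n z) \<longlonglongrightarrow> 1" "(\<lambda>n. ratio n z / h n z) \<longlonglongrightarrow> 1"
    by simp_all
  obtain N where N: "\<And>n. n \<ge> N \<Longrightarrow> h n z \<noteq> 0"
    using tendsto_imp_eventually_ne[OF lims(1), of 0] by (auto simp: eventually_sequentially)
  have "(\<lambda>n. y n z) \<longlonglongrightarrow> F z * (z * 1) / (1 - z\<^sup>2 * 1)"
  proof (rule affine_recurrence_tendsto)
    show "y (Suc n) z = z\<^sup>2 * ((ratio n z)\<^sup>2 * h (Suc n) z / h n z) * y n z
      + W n z * (z * (ratio n z / h n z))" if "n \<ge> N" for n
      using z N[OF that] by (intro y_Suc) auto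
    show "norm (z\<^sup>2 * 1) < 1" using z by (simp add: norm_power power_less_one_iff)
  qed (intro tendsto_intros r W)+
  then show ?thesis by (simp add: mult.commute)
qed

text \<open>Boundedness of \<open>p\<close> turns \<open>h \<longlonglongrightarrow> 1\<close> and
  \<open>ratio \<longlonglongrightarrow> 1\<close> into
  \<open>g n * X n \<longlonglongrightarrow> F z\<close>; then \<open>p\<close> is recovered from
  \<open>X\<close> and its conjugate.\<close>

lemma asymptotics_circle:
  assumes z: "z \<in> sphere 0 1 \<inter> jost_domain \<omega>"
  shows "(\<lambda>n. p n z - (z * F z / (1 - z\<^sup>2) * (1 / z ^ n) * (1 / growth n z)
     + z * cnj (F z) / (z\<^sup>2 - 1) * z ^ n * growth n z)) \<longlonglongrightarrow> 0"
proof -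
  have n1: "norm z = 1" and zU: "{z} \<subseteq> jost_domain \<omega>" and z0: "z \<noteq> 0" and z1: "z\<^sup>2 \<noteq> 1"
    using z jost_domainD[of z] by auto
  obtain G B N where G: "uniform_limit {z} W G sequentially" and B: "\<And>n. n \<ge> N \<Longrightarrow> norm (p n z) \<le> B"
  proof (rule W_uniform_limit_circle[of "{z}"])
    fix G B N assume a: "uniform_limit {z} W G sequentially"
      and b: "\<And>n w. N \<le> n \<Longrightarrow> w \<in> {z} \<Longrightarrow> norm (p n w) \<le> B"
    show thesis by (rule that[OF a]) (rule b, assumption, simp)
  qed (use z in auto)
  have W: "(\<lambda>n. W n z) \<longlonglongrightarrow> F z"
    using tendsto_uniform_limitI[OF uniform_limit_F[OF G]] by simp
  define X where "X n = p (Suc n) z - z * p n z" for n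
  define g where "g n = z ^ n * growth n z" for n
  have g1: "norm (g n) = 1" for n by (simp add: g_def norm_mult norm_power n1 norm_growth_circle)
  then have g0: "g n \<noteq> 0" for n by (metis norm_zero zero_neq_one)
  have zJ: "z \<in> jost_domain \<omega>" using zU by simp
  note lims = h_ratio_tendsto_pointwise[OF zJ] LIMSEQ_Suc[OF h_ratio_tendsto_pointwise(1)[OF zJ]]
  have "(\<lambda>n. h n z - 1) \<longlonglongrightarrow> 1 - 1" "(\<lambda>n. ratio n z * h (Suc n) z - 1) \<longlonglongrightarrow> 1 * 1 - 1"
    by (intro tendsto_intros lims)+
  then have r: "(\<lambda>n. h n z - 1) \<longlonglongrightarrow> 0" "(\<lambda>n. ratio n z * h (Suc n) z - 1) \<longlonglongrightarrow> 0"
    by simp_all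
  have Bp: "Bfun (\<lambda>n. p n z) sequentially" "Bfun (\<lambda>n. p (Suc n) z) sequentially"
    by (rule BfunI[of _ B], use B in \<open>force simp: eventually_sequentially\<close>,
        rule BfunI[of _ B], use B le_SucI in \<open>blast intro: eventually_sequentiallyI[of N]\<close>)
  have bounded_mult: "(\<lambda>n. u n * v n) \<longlonglongrightarrow> 0"
    if "u \<longlonglongrightarrow> 0" "Bfun v sequentially" for u v :: "nat \<Rightarrow> complex"
    using that bounded_bilinear.Zfun_prod_Bfun[OF bounded_bilinear_mult] by (simp add: tendsto_Zfun_iff)
  have "(\<lambda>n. (h n z - 1) * p (Suc n) z - z * ((ratio n z * h (Suc n) z - 1) * p n z)) \<longlonglongrightarrow> 0 - z * 0"
    by (intro tendsto_intros bounded_mult r Bp)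
  moreover have "Bfun g sequentially" using g1 by (intro BfunI[of _ 1]) auto
  ultimately have "(\<lambda>n. ((h n z - 1) * p (Suc n) z - z * ((ratio n z * h (Suc n) z - 1) * p n z)) * g n) \<longlonglongrightarrow> 0"
    by (intro bounded_mult) auto
  with W have "(\<lambda>n. W n z - ((h n z - 1) * p (Suc n) z - z * ((ratio n z * h (Suc n) z - 1) * p n z)) * g n) \<longlonglongrightarrow> F z - 0"
    by (intro tendsto_intros)
  moreover have "W n z - ((h n z - 1) * p (Suc n) z - z * ((ratio n z * h (Suc n) z - 1) * p n z)) * g n = g n * X n" for n
    by (simp add: W_def g_def X_def algebra_simps)
  ultimately have gX: "(\<lambda>n. g n * X n - F z) \<longlonglongrightarrow> 0"
    by (simp add: LIM_zero_iff)
  have cg: "cnj (g n) = 1 / g n" for n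
    using g1[of n] by (simp add: cnj_eq_inverse_of_unit)
  \<comment> \<open>Since \<open>cnj (g n) = 1 / g n\<close>, the error is a combination of the
    error in \<open>g n * X n\<close> and its conjugate, with unimodular weights up to a fixed
    factor.\<close>
  have eq: "p n z - (z * F z / (1 - z\<^sup>2) * (1 / z ^ n) * (1 / growth n z)
     + z * cnj (F z) / (z\<^sup>2 - 1) * z ^ n * growth n z)
     = z / (1 - z\<^sup>2) * ((1 / g n) * (g n * X n - F z) - g n * cnj (g n * X n - F z))" for n
  proof -
    have "(1 / g n) * (g n * X n - F z) - g n * cnj (g n * X n - F z)
        = (X n - cnj (X n)) - (F z / g n - g n * cnj (F z))"
      using g0[of n] by (simp add: cg field_simps)
    then have "z / (1 - z\<^sup>2) * ((1 / g n) * (g n * X n - F z) - g n * cnj (g n * X n - F z))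
      = z / (1 - z\<^sup>2) * (X n - cnj (X n)) - z / (1 - z\<^sup>2) * (F z / g n - g n * cnj (F z))"
      by (simp only: right_diff_distrib[of _ "X n - cnj (X n)"])
    also have "z / (1 - z\<^sup>2) * (X n - cnj (X n)) = p n z"
      using p_eq_circle(1)[OF n1 z1, of n] by (simp add: X_def)
    also have "z / (1 - z\<^sup>2) * (F z / g n - g n * cnj (F z)) = z * F z / (1 - z\<^sup>2) * (1 / g n) + z * cnj (F z) / (z\<^sup>2 - 1) * g n"
    proof -
      have "z * cnj (F z) / (z\<^sup>2 - 1) = - (z * cnj (F z) / (1 - z\<^sup>2))"
        by (metis minus_diff_eq divide_minus_right)
      then show ?thesis by (simp add: algebra_simps)
    qed
    finally show ?thesis by (simp add: g_def mult.assoc)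
  qed
  have Bg: "Bfun (\<lambda>n. 1 / g n) sequentially" "Bfun g sequentially"
    using g1 by (auto intro!: BfunI[of _ 1] simp: norm_divide)
  have cX: "(\<lambda>n. cnj (g n * X n - F z)) \<longlonglongrightarrow> 0"
    using tendsto_cnj[OF gX] by simp
  have "(\<lambda>n. z / (1 - z\<^sup>2) * ((g n * X n - F z) * (1 / g n) - cnj (g n * X n - F z) * g n)) \<longlonglongrightarrow> z / (1 - z\<^sup>2) * (0 - 0)"
    by (intro tendsto_mult tendsto_const tendsto_diff bounded_mult gX cX Bg)
  then show ?thesis unfolding eq by (simp add: mult.commute)
qed

end

theorem theorem1:
  fixes c \<omega> \<delta> \<gamma> :: real and q b :: "nat \<Rightarrow> real"
  assumes "1 / 3 < \<gamma>" and "\<gamma> < 1 / 2"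
    and "\<not> (\<exists>k::int. 2 * \<omega> = pi * of_int k)"
    and "summable (\<lambda>n. \<bar>q n\<bar>)"
    and "\<And>n. n \<ge> 1 \<Longrightarrow> b n = c * sin (2 * \<omega> * real n + \<delta>) / real n powr \<gamma> + q n"
  shows "\<exists>F :: complex \<Rightarrow> complex.
    (\<forall>z \<in> ball 0 1 - {0}.
      (\<lambda>n. poly (jacobi_poly b n) (z + 1 / z)
           - z * F z / (1 - z\<^sup>2) * (1 / z ^ n)
             * exp (mu2 c \<omega> z * of_real (real n powr (1 - 2 * \<gamma>)) / of_real (1 - 2 * \<gamma>)))
      \<in> o[sequentially](\<lambda>n. complex_of_real
           (1 / norm z ^ n * exp (Re (mu2 c \<omega> z) * real n powr (1 - 2 * \<gamma>) / (1 - 2 * \<gamma>))))) \<and>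
    (\<forall>z \<in> sphere 0 1 \<inter> jost_domain \<omega>.
      (\<lambda>n. poly (jacobi_poly b n) (z + 1 / z)
           - (z * F z / (1 - z\<^sup>2) * (1 / z ^ n)
               * exp (mu2 c \<omega> z * of_real (real n powr (1 - 2 * \<gamma>)) / of_real (1 - 2 * \<gamma>))
             + z * cnj (F z) / (z\<^sup>2 - 1) * z ^ n
               * exp (- (mu2 c \<omega> z * of_real (real n powr (1 - 2 * \<gamma>)) / of_real (1 - 2 * \<gamma>)))))
      \<in> o[sequentially](\<lambda>_. 1)) \<and>
    F analytic_on (ball 0 1 - {0}) \<and>
    continuous_on (sphere 0 1 \<inter> jost_domain \<omega>) F"
proof -
  interpret oscillating_jacobi c \<omega> \<delta> \<gamma> q b
    using assms by unfold_locales
  have exp_eq: "exp (mu2 c \<omega> z * of_real (real n powr (1 - 2 * \<gamma>)) / of_real (1 - 2 * \<gamma>)) = 1 / growth n z"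
    "exp (- (mu2 c \<omega> z * of_real (real n powr (1 - 2 * \<gamma>)) / of_real (1 - 2 * \<gamma>))) = growth n z" for n z
    by (simp_all add: growth_def s_def exp_minus inverse_eq_divide)
  have disc: "(\<lambda>n. poly (jacobi_poly b n) (z + 1 / z) - z * F z / (1 - z\<^sup>2) * (1 / z ^ n) * (1 / growth n z))
      \<in> o[sequentially](\<lambda>n. complex_of_real
           (1 / norm z ^ n * exp (Re (mu2 c \<omega> z) * real n powr (1 - 2 * \<gamma>) / (1 - 2 * \<gamma>))))"
    if z: "z \<in> ball 0 1 - {0}" for z
  proof -
    have nz: "z ^ n * growth n z \<noteq> 0" for n using z growth_nz by auto
    have "norm (growth n z) = 1 / exp (Re (mu2 c \<omega> z) * real n powr (1 - 2 * \<gamma>) / (1 - 2 * \<gamma>))" for n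
    proof -
      have "norm (growth n z) = exp (- (Re (mu2 c \<omega> z) * s n))" by (simp add: growth_def norm_exp_eq_Re)
      then show ?thesis by (simp add: s_def exp_minus inverse_eq_divide)
    qed
    \<comment> \<open>The real comparison function is the norm of a complex one; dividing by the
      latter yields exactly \<open>y n z\<close> minus its limit.\<close>
    then have norm_eq: "1 / norm z ^ n * exp (Re (mu2 c \<omega> z) * real n powr (1 - 2 * \<gamma>) / (1 - 2 * \<gamma>))
        = norm (1 / (z ^ n * growth n z))" for n
      by (simp add: norm_mult norm_divide norm_power)
    have "(\<lambda>n. p n z - z * F z / (1 - z\<^sup>2) * (1 / z ^ n) * (1 / growth n z))
      \<in> o[sequentially](\<lambda>n. 1 / (z ^ n * growth n z))"
    proof (rule smalloI_tendsto)
      have "(\<lambda>n. y n z - z * F z / (1 - z\<^sup>2)) \<longlonglongrightarrow> 0"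
        using asymptotics_disc[OF z] by (simp add: LIM_zero_iff)
      moreover have "y n z - z * F z / (1 - z\<^sup>2) =
        (p n z - z * F z / (1 - z\<^sup>2) * (1 / z ^ n) * (1 / growth n z)) / (1 / (z ^ n * growth n z))" for n
      proof -
        have "(u - v * (1 / a) * (1 / g)) / (1 / (a * g)) = a * g * u - v" if "a * g \<noteq> 0" for u v a g :: complex
          using that by (simp add: field_simps)
        from this[OF nz] show ?thesis unfolding y_def by (rule sym)
      qed
      ultimately show "(\<lambda>n. (p n z - z * F z / (1 - z\<^sup>2) * (1 / z ^ n) * (1 / growth n z)) / (1 / (z ^ n * growth n z))) \<longlonglongrightarrow> 0"
        by simp
    qed (use nz in auto)
    then show ?thesis
      unfolding norm_eq p_def by (simp only: landau_o.small.norm_iff smallo_def norm_of_real abs_norm_cancel)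
  qed
  have circle: "(\<lambda>n. poly (jacobi_poly b n) (z + 1 / z) - (z * F z / (1 - z\<^sup>2) * (1 / z ^ n) * (1 / growth n z)
     + z * cnj (F z) / (z\<^sup>2 - 1) * z ^ n * growth n z)) \<in> o[sequentially](\<lambda>_. 1)"
    if "z \<in> sphere 0 1 \<inter> jost_domain \<omega>" for z
    using asymptotics_circle[OF that] by (intro smalloI_tendsto) (auto simp: p_def)
  show ?thesis
    unfolding exp_eq using disc circle F_analytic F_continuous by blast
qed

end
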